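(* Let $p<-1$, let $T$ be the Gaspard–Wang map of $[0,1]$ with parameter $p$, and let $\mu$ be its unique absolutely continuous invariant probability measure. Then the return time dimensions satisfy, for every grid $\theta$, $$D^\pm_\tau(q)=\Delta^\pm_\tau(\theta,q)=\infty\quad\text{for all } q<q_c:=p+1,$$ while the measure dimensions take the values $$D^\pm_\mu(q)=1\ \text{ for } q\le-p,\qquad D^\pm_\mu(q)=\Bigl(1+\frac1p\Bigr)\frac{q}{q-1}\ \text{ for } q\ge-p.$$
   Context: The Gaspard–Wang map with parameter $p<-1$: let $c_j=(j+1)^p$ for $j=0,1,2,\dots$, $I_j=(c_{j+1},c_j)$, $l_j=c_j-c_{j+1}$ for $j\ge0$, and $l_{-1}=1$; let $d_j=c_j$ for $j>0$ and $d_0=0$. Then $T(x)=(x-c_{j+1})\frac{l_{j-1}}{l_j}+d_j$ for $x\in I_j$. So $T$ maps $I_j$ affinely, with positive slope, onto $I_{j-1}$ for $j\ge1$, and $I_0$ onto $(0,1)$; $0$ is a fixed point, and values at the remaining (countably many) endpoints are irrelevant. Set $X=[0,1]$. $B_\varepsilon(x)$ is the ball (in $X$) of radius $\varepsilon$ centered at $x$. For measurable $A$ and $x\in A$, $\tau_A(x)=\inf\{m>0:\ T^m(x)\in A\}$ is the first return time. Generalized dimensions: for $q\neq1$ let $\Gamma_\mu(\varepsilon,q)=\int_X[\mu(B_\varepsilon(x))]^{q-1}d\mu(x)$ and $\Gamma_\tau(\varepsilon,q)=\int_X[\tau_{B_\varepsilon(x)}(x)]^{1-q}d\mu(x)$.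 For $\sigma\in\{\mu,\tau\}$ and $q\ne1$, $D^+_\sigma(q)$ and $D^-_\sigma(q)$ are the limsup and liminf, as $\varepsilon\to0$, of $\frac{1}{q-1}\frac{\log\Gamma_\sigma(\varepsilon,q)}{\log\varepsilon}$; for $q=1$, $D^\pm_\mu(1)$ are the limsup and liminf of $\frac{1}{\log\varepsilon}\int_X\log[\mu(B_\varepsilon(x))]d\mu(x)$. Grids and box dimensions: a grid $\theta$ is a choice of origin and orientation in $\mathbb{R}$; for each $\varepsilon>0$ it determines the partition of the line into (half-open) intervals $A_j$ of length $\varepsilon$ having the origin of $\theta$ as an endpoint of one of them (intersected with $X$). For $q\neq1$ let $\Upsilon_\tau(\theta,\varepsilon,q)=\sum_j\int_{A_j}\tau_{A_j}^{1-q}(x)\,d\mu(x)$; $\Delta^+_\tau(\theta,q)$ and $\Delta^-_\tau(\theta,q)$ are the limsup and liminf, as $\varepsilon\to0$, of $\frac{1}{q-1}\frac{\log\Upsilon_\tau(\theta,\varepsilon,q)}{\log\varepsilon}$. A partition function whose integrand is not summable has value $+\infty$, and then the corresponding dimension is $+\infty$. *)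

theory Defs
  imports "HOL-Probability.Probability"
begin

definition phase_space :: "real set" where
  "phase_space = {0..1}"

definition gw_c :: "real \<Rightarrow> nat \<Rightarrow> real" where
  "gw_c p j = real (j + 1) powr p"

definition gw_I :: "real \<Rightarrow> nat \<Rightarrow> real set" where
  "gw_I p j = {gw_c p (j + 1) <..< gw_c p j}"

definition gw_l :: "real \<Rightarrow> int \<Rightarrow> real" where
  "gw_l p j = (if j = -1 then 1 else gw_c p (nat j) - gw_c p (nat (j + 1)))"

definition gw_d :: "real \<Rightarrow> nat \<Rightarrow> real" where
  "gw_d p j = (if j = 0 then 0 else gw_c p j)"

text \<open>The values at the endpoints \<open>gw_c p j\<close> are immaterial, so any map of the phase
  space with the prescribed affine branches counts as a Gaspard--Wang map.\<close>

definition gaspard_wang_map :: "real \<Rightarrow> (real \<Rightarrow> real) \<Rightarrow> bool" where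
  "gaspard_wang_map p T \<longleftrightarrow>
     T \<in> phase_space \<rightarrow> phase_space \<and>
     T 0 = 0 \<and>
     (\<forall>j. \<forall>x \<in> gw_I p j.
        T x = (x - gw_c p (j + 1)) * (gw_l p (int j - 1) / gw_l p (int j)) + gw_d p j)"

definition acip :: "(real \<Rightarrow> real) \<Rightarrow> real measure \<Rightarrow> bool" where
  "acip T \<mu> \<longleftrightarrow>
     sets \<mu> = sets (restrict_space borel phase_space) \<and>
     prob_space \<mu> \<and>
     absolutely_continuous (restrict_space lborel phase_space) \<mu> \<and>
     T \<in> measurable \<mu> \<mu> \<and> distr \<mu> \<mu> T = \<mu>"

text \<open>The return time is \<open>\<infinity>\<close> when the orbit never returns (infimum of the empty set).\<close>

definition return_time :: "(real \<Rightarrow> real) \<Rightarrow> real set \<Rightarrow> real \<Rightarrow> ennreal" where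
  "return_time T A x = (INF m \<in> {m. 0 < m \<and> (T ^^ m) x \<in> A}. of_nat m)"

definition X_ball :: "real \<Rightarrow> real \<Rightarrow> real set" where
  "X_ball x \<epsilon> = ball x \<epsilon> \<inter> phase_space"

text \<open>Power and logarithm on \<open>[0, \<infinity>]\<close>; the real-valued \<open>powr\<close> and \<open>ln\<close> have
  \<open>0 powr a = 0\<close> for every \<open>a\<close> and \<open>ln 0 = 0\<close>, which is not what is wanted at the
  boundary.\<close>

definition epowr :: "ennreal \<Rightarrow> real \<Rightarrow> ennreal" where
  "epowr x a =
     (if a = 0 then 1
      else if x = 0 then (if 0 < a then 0 else \<infinity>)
      else if x = \<infinity> then (if 0 < a then \<infinity> else 0)
      else ennreal (enn2real x powr a))"

definition elog :: "ennreal \<Rightarrow> ereal" where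
  "elog x = (if x = 0 then -\<infinity> else if x = \<infinity> then \<infinity> else ereal (ln (enn2real x)))"

definition Gamma_mu :: "real measure \<Rightarrow> real \<Rightarrow> real \<Rightarrow> ennreal" where
  "Gamma_mu \<mu> \<epsilon> q = (\<integral>\<^sup>+ x. epowr (emeasure \<mu> (X_ball x \<epsilon>)) (q - 1) \<partial>\<mu>)"

definition Gamma_tau :: "(real \<Rightarrow> real) \<Rightarrow> real measure \<Rightarrow> real \<Rightarrow> real \<Rightarrow> ennreal" where
  "Gamma_tau T \<mu> \<epsilon> q = (\<integral>\<^sup>+ x. epowr (return_time T (X_ball x \<epsilon>) x) (1 - q) \<partial>\<mu>)"

text \<open>The grid has origin \<open>a\<close> and orientation \<open>s \<in> {-1, 1}\<close>: its cells are the images of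
  \<open>[k \<epsilon>, (k + 1) \<epsilon>)\<close> under \<open>t \<mapsto> a + s t\<close>, so that for \<open>s = -1\<close> they are closed on
  the right.\<close>

definition grid_cell :: "real \<Rightarrow> real \<Rightarrow> real \<Rightarrow> int \<Rightarrow> real set" where
  "grid_cell a s \<epsilon> k = (\<lambda>t. a + s * t) ` {of_int k * \<epsilon> ..< (of_int k + 1) * \<epsilon>} \<inter> phase_space"

definition Upsilon_tau ::
  "(real \<Rightarrow> real) \<Rightarrow> real measure \<Rightarrow> real \<Rightarrow> real \<Rightarrow> real \<Rightarrow> real \<Rightarrow> ennreal" where
  "Upsilon_tau T \<mu> a s \<epsilon> q =
     (\<Sum>\<^sub>\<infinity> k. \<integral>\<^sup>+ x \<in> grid_cell a s \<epsilon> k. epowr (return_time T (grid_cell a s \<epsilon> k) x) (1 - q) \<partial>\<mu>)"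

text \<open>With \<open>q < 1\<close> and \<open>\<epsilon> < 1\<close> an infinite partition function gives the value \<open>+\<infinity>\<close>
  here, and partition functions with \<open>q > 1\<close> are at most 1.\<close>

definition scaling_quotient :: "real \<Rightarrow> (real \<Rightarrow> ennreal) \<Rightarrow> real \<Rightarrow> ereal" where
  "scaling_quotient q Z \<epsilon> = ereal (1 / (q - 1)) * (elog (Z \<epsilon>) / ereal (ln \<epsilon>))"

text \<open>For \<open>q = 1\<close> the case distinction prevents a nonintegrable logarithm from
  being given the integral 0.\<close>

definition mu_quotient :: "real measure \<Rightarrow> real \<Rightarrow> real \<Rightarrow> ereal" where
  "mu_quotient \<mu> q \<epsilon> =
     (if q = 1 then
        (if integrable \<mu> (\<lambda>x. ln (measure \<mu> (X_ball x \<epsilon>)))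
         then ereal (1 / ln \<epsilon> * (\<integral>x. ln (measure \<mu> (X_ball x \<epsilon>)) \<partial>\<mu>))
         else \<infinity>)
      else scaling_quotient q (\<lambda>\<epsilon>. Gamma_mu \<mu> \<epsilon> q) \<epsilon>)"

definition D_mu_plus :: "real measure \<Rightarrow> real \<Rightarrow> ereal" where
  "D_mu_plus \<mu> q = Limsup (at_right 0) (mu_quotient \<mu> q)"

definition D_mu_minus :: "real measure \<Rightarrow> real \<Rightarrow> ereal" where
  "D_mu_minus \<mu> q = Liminf (at_right 0) (mu_quotient \<mu> q)"

text \<open>The return time dimensions are only meant for \<open>q \<noteq> 1\<close>.\<close>

definition D_tau_plus :: "(real \<Rightarrow> real) \<Rightarrow> real measure \<Rightarrow> real \<Rightarrow> ereal" where
  "D_tau_plus T \<mu> q = Limsup (at_right 0) (scaling_quotient q (\<lambda>\<epsilon>. Gamma_tau T \<mu> \<epsilon> q))"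

definition D_tau_minus :: "(real \<Rightarrow> real) \<Rightarrow> real measure \<Rightarrow> real \<Rightarrow> ereal" where
  "D_tau_minus T \<mu> q = Liminf (at_right 0) (scaling_quotient q (\<lambda>\<epsilon>. Gamma_tau T \<mu> \<epsilon> q))"

definition Delta_tau_plus ::
  "(real \<Rightarrow> real) \<Rightarrow> real measure \<Rightarrow> real \<Rightarrow> real \<Rightarrow> real \<Rightarrow> ereal" where
  "Delta_tau_plus T \<mu> a s q =
     Limsup (at_right 0) (scaling_quotient q (\<lambda>\<epsilon>. Upsilon_tau T \<mu> a s \<epsilon> q))"

definition Delta_tau_minus ::
  "(real \<Rightarrow> real) \<Rightarrow> real measure \<Rightarrow> real \<Rightarrow> real \<Rightarrow> real \<Rightarrow> ereal" where
  "Delta_tau_minus T \<mu> a s q =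
     Liminf (at_right 0) (scaling_quotient q (\<lambda>\<epsilon>. Upsilon_tau T \<mu> a s \<epsilon> q))"

end

theory Submission
  imports Defs
begin

text \<open>On \<open>I\<^sub>0\<close> the first return map of \<open>T\<close> is, after rescaling to \<open>(0, 1)\<close>, the map
  sending each \<open>I\<^sub>k\<close> affinely onto \<open>(0, 1)\<close>. It is mixing for Lebesgue measure, so Lebesgue
  measure is its only absolutely continuous invariant measure up to scaling. Consequently the
  density of \<open>\<mu>\<close> is a multiple of \<open>c\<^sub>k / l\<^sub>k\<close> on \<open>I\<^sub>k\<close>, hence comparable to
  \<open>x powr (1 / p)\<close>. The points of \<open>I\<^sub>0\<close> that \<open>T\<close> maps below \<open>c\<^sub>k\<close> have measure
  proportional to \<open>c\<^sub>k\<close> and need at least \<open>k\<close> steps to come back, so Markov's inequality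
  makes the return time partition functions infinite for \<open>q < p + 1\<close>. For the measure
  dimensions, with \<open>beta = - 1 / p\<close>, the \<open>\<epsilon>\<close>-ball at \<open>x\<close> has measure comparable to
  \<open>\<epsilon> * max x \<epsilon> powr - beta\<close>; the bulk contributes \<open>\<epsilon> powr (q - 1)\<close> to the partition
  function and the neighbourhood of \<open>0\<close> contributes \<open>\<epsilon> powr ((1 - beta) * q)\<close>. The case
  \<open>q = 1\<close> follows from \<open>q = - p\<close> by Jensen's inequality.\<close>

subsection \<open>Mixing of the full-branch affine map\<close>

text \<open>The invariant measure is arbitrary, so its density has to be deduced rather than guessed
  and checked. Two facts make this exact. In affine cell coordinates \<open>T\<close> carries
  I_(k+1) to I_k without changing the coordinate, so invariance telescopes and \<mu> is determined
  by its values on I_0. On I_0, mixing forces uniqueness: an invariant measure with an integrable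
  density gives all iterated preimages of A the same mass, while these masses converge to a multiple
  of the length of A. Mixing is elementary here, because an affine branch reproduces a set exactly
  up to scale, so the preimages can fail to be equidistributed only inside one cell, by an amount
  that shrinks geometrically. This half of the argument uses nothing about powers, only a sequence
  decreasing strictly from 1 to 0; hence its own locale.\<close>

locale interval_chain =
  fixes c :: "nat \<Rightarrow> real"
  assumes c_0: "c 0 = 1"
    and c_Suc_less: "c (Suc k) < c k"
    and c_tendsto_0: "c \<longlonglongrightarrow> 0"
begin

definition cell :: "nat \<Rightarrow> real set" where
  "cell k = {c (Suc k)<..<c k}"

definition len :: "nat \<Rightarrow> real" where
  "len k = c k - c (Suc k)"

definition branch :: "nat \<Rightarrow> real \<Rightarrow> real" where
  "branch k x = (x - c (Suc k)) / len k"

definition piece :: "nat \<Rightarrow> real set \<Rightarrow> real set" where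
  "piece k B = {x \<in> cell k. branch k x \<in> B}"

text \<open>The preimage of B under the map that equals \<open>branch k\<close> on each cell.
  Working with preimages alone avoids choosing values of that map at the endpoints.\<close>

definition pre :: "real set \<Rightarrow> real set" where
  "pre B = (\<Union>k. piece k B)"

lemma decseq_c: "decseq c"
  by (rule decseq_SucI) (simp add: c_Suc_less less_imp_le)

lemma c_antimono: "j \<le> k \<Longrightarrow> c k \<le> c j"
  using decseq_c by (rule decseqD)

lemma c_pos: "c k > 0"
  using decseq_ge[OF decseq_c c_tendsto_0, of "Suc k"] c_Suc_less[of k] by linarith

lemma c_le_1: "c k \<le> 1"
  using c_antimono[of 0 k] c_0 by simp

lemma len_pos: "len k > 0"
  using c_Suc_less[of k] by (simp add: len_def)

lemma len_sums: "(\<lambda>i. len (k + i)) sums c k"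
proof -
  have "(\<lambda>i. c (k + i)) \<longlonglongrightarrow> 0"
    using LIMSEQ_ignore_initial_segment[OF c_tendsto_0, of k] by (simp add: add.commute)
  from telescope_sums'[OF this] show ?thesis
    by (simp add: len_def)
qed

text \<open>Cells are closed on the right here so that every point of (0, 1], endpoints included,
  gets an index; the discrepancy recursion is run at all such points.\<close>

lemma index_exists:
  assumes "0 < x" "x \<le> 1"
  obtains k where "c (Suc k) < x" "x \<le> c k"
proof -
  have "\<exists>n. c n < x"
    using order_tendstoD(2)[OF c_tendsto_0 assms(1)] by (auto simp: eventually_sequentially)
  then have ex: "c (LEAST n. c n < x) < x"
    by (rule LeastI_ex)
  have "(LEAST n. c n < x) \<noteq> 0"
    using ex assms(2) c_0 by (metis not_less)
  then obtain k where k: "(LEAST n. c n < x) = Suc k"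
    using not0_implies_Suc by blast
  then have "\<not> c k < x"
    by (metis not_less_Least lessI)
  with ex k that show ?thesis by fastforce
qed

lemma cell_disjoint: "i \<noteq> j \<Longrightarrow> cell i \<inter> cell j = {}"
proof (induction i j rule: linorder_wlog)
  case (le i j)
  then have "c j \<le> c (Suc i)"
    by (intro c_antimono) simp
  then show ?case by (auto simp: cell_def)
qed (simp add: Int_commute)

lemma disjoint_family_cell: "disjoint_family cell"
  by (auto simp: disjoint_family_on_def cell_disjoint)

lemma cell_subset: "cell k \<subseteq> {0<..<1}"
  using c_pos[of "Suc k"] c_le_1[of k] by (auto simp: cell_def)

lemma cell_borel [measurable, simp]: "cell k \<in> sets borel"
  by (simp add: cell_def)

lemma cell_cover: "{0<..1} - range c \<subseteq> (\<Union>k. cell k)"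
proof
  fix x assume x: "x \<in> {0<..1} - range c"
  then obtain k where "c (Suc k) < x" "x \<le> c k"
    using index_exists by auto
  with x have "x \<in> cell k"
    by (auto simp: cell_def order_less_le)
  then show "x \<in> (\<Union>k. cell k)" by blast
qed

lemma branch_measurable [measurable]: "branch k \<in> borel_measurable borel"
  unfolding branch_def by measurable

lemma branch_in_unit_iff: "branch k x \<in> {0<..<1} \<longleftrightarrow> x \<in> cell k"
  using len_pos[of k] by (auto simp: branch_def cell_def field_simps len_def)

lemma branch_lessI: "x < y \<Longrightarrow> branch k x < branch k y"
  using len_pos[of k] by (simp add: branch_def divide_strict_right_mono)

lemma piece_subset_cell: "piece k B \<subseteq> cell k"
  by (auto simp: piece_def)

lemma piece_borel [measurable, simp]:
  assumes [measurable]: "B \<in> sets borel"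
  shows "piece k B \<in> sets borel"
  unfolding piece_def by measurable

lemma pre_borel [measurable, simp]: "B \<in> sets borel \<Longrightarrow> pre B \<in> sets borel"
  unfolding pre_def by auto

lemma pre_subset: "pre B \<subseteq> {0<..<1}"
  unfolding pre_def using piece_subset_cell cell_subset by fastforce

lemma disjoint_family_piece: "disjoint_family (\<lambda>i. piece i B)"
  using disjoint_family_subset[OF disjoint_family_cell] piece_subset_cell by metis

lemma piece_eq_vimage: "B \<subseteq> {0<..<1} \<Longrightarrow> piece k B = branch k -` B"
  using branch_in_unit_iff[of k] by (auto simp: piece_def)

lemma emeasure_branch_vimage:
  assumes [measurable]: "B \<in> sets borel"
  shows "emeasure lborel (branch k -` B) = ennreal (len k) * emeasure lborel B"
proof -
  have [measurable]: "branch k -` B \<in> sets borel"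
    using measurable_sets[OF branch_measurable assms] by simp
  have "emeasure lborel (branch k -` B) = (\<integral>\<^sup>+x. indicator (branch k -` B) x \<partial>lborel)"
    by simp
  also have "\<dots> = ennreal \<bar>len k\<bar> *
      (\<integral>\<^sup>+y. indicator (branch k -` B) (c (Suc k) + len k * y) \<partial>lborel)"
    using len_pos[of k] by (intro nn_integral_real_affine) auto
  also have "(\<lambda>y. indicator (branch k -` B) (c (Suc k) + len k * y) :: ennreal) = indicator B"
    using len_pos[of k] by (auto simp: fun_eq_iff indicator_def branch_def)
  finally show ?thesis
    using len_pos[of k] by simp
qed

lemma emeasure_piece:
  assumes "B \<in> sets borel" "B \<subseteq> {0<..<1}"
  shows "emeasure lborel (piece k B) = ennreal (len k) * emeasure lborel B"
  using assms by (simp add: piece_eq_vimage emeasure_branch_vimage)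

lemma suminf_len: "(\<Sum>i. ennreal (len (k + i))) = ennreal (c k)"
  using len_sums[of k] len_pos by (intro suminf_ennreal_eq) (auto intro: less_imp_le)

lemma pre_Int_lessThan: "pre B \<inter> {..<c k} = (\<Union>i. piece (k + i) B)"
proof safe
  fix x assume "x \<in> pre B" "x < c k"
  then obtain j where j: "x \<in> piece j B" by (auto simp: pre_def)
  have "k \<le> j"
  proof (rule ccontr)
    assume "\<not> k \<le> j"
    then have "c k \<le> c (Suc j)" by (intro c_antimono) simp
    moreover have "c (Suc j) < x" using j by (auto simp: piece_def cell_def)
    ultimately show False using \<open>x < c k\<close> by simp
  qed
  with j show "x \<in> (\<Union>i. piece (k + i) B)"
    by (metis UN_I UNIV_I le_add_diff_inverse)
next
  fix x i assume x: "x \<in> piece (k + i) B"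
  then show "x \<in> pre B" by (auto simp: pre_def)
  from x have "x < c (k + i)" by (auto simp: piece_def cell_def)
  then show "x < c k" using c_antimono[of k "k + i"] by simp
qed

text \<open>Each piece is an affine copy of B, and the cell lengths from k on telescope to
  \<open>c k\<close>. So below an endpoint the preimage occupies exactly the proportion that B
  occupies in the unit interval.\<close>

lemma emeasure_pre_Int_lessThan:
  assumes "B \<in> sets borel" "B \<subseteq> {0<..<1}"
  shows "emeasure lborel (pre B \<inter> {..<c k}) = ennreal (c k) * emeasure lborel B"
proof -
  have "disjoint_family (\<lambda>i. piece (k + i) B)"
    using disjoint_family_piece[of B] by (auto simp: disjoint_family_on_def)
  then have "emeasure lborel (pre B \<inter> {..<c k}) = (\<Sum>i. emeasure lborel (piece (k + i) B))"
    using assms by (subst pre_Int_lessThan) (auto intro!: suminf_emeasure[symmetric])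
  also have "\<dots> = (\<Sum>i. ennreal (len (k + i)) * emeasure lborel B)"
    using assms by (simp add: emeasure_piece)
  also have "\<dots> = ennreal (c k) * emeasure lborel B"
    by (simp add: suminf_len)
  finally show ?thesis .
qed

lemma emeasure_pre:
  assumes "B \<in> sets borel" "B \<subseteq> {0<..<1}"
  shows "emeasure lborel (pre B) = emeasure lborel B"
proof -
  have "pre B \<inter> {..<c 0} = pre B" using pre_subset[of B] by (auto simp: c_0)
  with emeasure_pre_Int_lessThan[OF assms, of 0] show ?thesis by (simp add: c_0)
qed

lemma emeasure_unit_finite: "B \<subseteq> {0<..<1::real} \<Longrightarrow> emeasure lborel B < \<infinity>"
  by (rule le_less_trans[OF emeasure_mono[of _ "{0<..<1}"]]) auto

text \<open>All cells below the one containing t contribute their exact proportion, and the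
  remaining part is an affine copy of B cut at \<open>branch k t\<close>. Deviation from
  proportionality can therefore come only from the cell of t.\<close>

lemma measure_pre_step:
  assumes B: "B \<in> sets borel" "B \<subseteq> {0<..<1}" and t: "c (Suc k) < t" "t \<le> c k"
  shows "measure lborel (pre B \<inter> {..t}) =
    c (Suc k) * measure lborel B + len k * measure lborel (B \<inter> {..branch k t})"
proof -
  note [measurable] = B(1)
  have split: "pre B \<inter> {..t} = (pre B \<inter> {..<c (Suc k)}) \<union> piece k (B \<inter> {..branch k t})"
  proof safe
    fix x assume x: "x \<in> pre B" "x \<le> t" "x \<notin> piece k (B \<inter> {..branch k t})"
    then obtain j where j: "x \<in> piece j B" by (auto simp: pre_def)
    have br: "branch k x \<le> branch k t"
      using branch_lessI[of x t k] \<open>x \<le> t\<close> by (cases "x = t") auto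
    show "x < c (Suc k)"
    proof (cases j k rule: linorder_cases)
      case less
      then have "c k \<le> c (Suc j)" by (intro c_antimono) simp
      then show ?thesis using j x(2) t(2) by (auto simp: piece_def cell_def)
    next
      case equal
      then show ?thesis using j x(3) br by (auto simp: piece_def)
    next
      case greater
      then have "c j \<le> c (Suc k)" by (intro c_antimono) simp
      then show ?thesis using j by (auto simp: piece_def cell_def)
    qed
  next
    fix x assume x: "x \<in> piece k (B \<inter> {..branch k t})"
    then show "x \<in> pre B" by (auto simp: pre_def piece_def)
    show "x \<le> t"
      using x branch_lessI[of t x k] by (cases "x \<le> t") (auto simp: piece_def)
  qed (use t in auto)
  have disj: "(pre B \<inter> {..<c (Suc k)}) \<inter> piece k (B \<inter> {..branch k t}) = {}"
    by (auto simp: piece_def cell_def)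
  have sub: "B \<inter> {..branch k t} \<subseteq> {0<..<1}" using B by auto
  have fin: "emeasure lborel (pre B \<inter> {..<c (Suc k)}) \<noteq> \<infinity>"
      "emeasure lborel (piece k (B \<inter> {..branch k t})) \<noteq> \<infinity>"
    using emeasure_unit_finite[of "pre B \<inter> {..<c (Suc k)}"] pre_subset[of B]
      emeasure_unit_finite[of "piece k (B \<inter> {..branch k t})"]
      piece_subset_cell[of k "B \<inter> {..branch k t}"] cell_subset[of k]
    by (auto simp: less_top[symmetric])
  have "measure lborel (pre B \<inter> {..t}) =
      measure lborel (pre B \<inter> {..<c (Suc k)}) + measure lborel (piece k (B \<inter> {..branch k t}))"
    unfolding split using fin disj by (intro measure_Union) auto
  also have "measure lborel (pre B \<inter> {..<c (Suc k)}) = c (Suc k) * measure lborel B"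
    using emeasure_pre_Int_lessThan[OF B, of "Suc k"] c_pos[of "Suc k"]
    by (simp add: measure_def enn2real_mult less_imp_le)
  also have "measure lborel (piece k (B \<inter> {..branch k t})) = len k * measure lborel (B \<inter> {..branch k t})"
    using emeasure_piece[OF _ sub, of k] len_pos[of k]
    by (simp add: measure_def enn2real_mult less_imp_le)
  finally show ?thesis .
qed

section \<open>Equidistribution of iterated preimages\<close>

lemma iterated_pre:
  assumes "A \<in> sets borel" "A \<subseteq> {0<..<1}"
  shows "(pre ^^ n) A \<in> sets borel" "(pre ^^ n) A \<subseteq> {0<..<1}"
    "measure lborel ((pre ^^ n) A) = measure lborel A"
proof (induction n)
  case (Suc n)
  { case 1 then show ?case using Suc by simp }
  { case 2 then show ?case using pre_subset by simp }
  { case 3 then show ?case using Suc by (simp add: measure_def emeasure_pre) }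
qed (use assms in auto)

text \<open>One rate for all cells: \<open>len 0\<close> serves the first, and all later cells lie
  in (0, \<open>c 1\<close>). Both numbers are below 1.\<close>

definition contraction :: real where
  "contraction = max (len 0) (c 1)"

lemma contraction_bounds: "0 < contraction" "contraction < 1" "len k \<le> contraction"
proof -
  show "0 < contraction" "contraction < 1"
    using c_pos[of 1] c_Suc_less[of 0] c_0 by (auto simp: contraction_def len_def)
  show "len k \<le> contraction"
  proof (cases k)
    case (Suc j)
    have "len k \<le> c k" using c_pos[of "Suc k"] by (simp add: len_def)
    also have "c k \<le> c 1" using Suc by (intro c_antimono) simp
    finally show ?thesis by (simp add: contraction_def)
  qed (simp add: contraction_def)
qed

text \<open>Every branch is affine, so the discrepancy at \<open>t\<close> of one more preimage is that of the
  previous one at the image of \<open>t\<close>, scaled by the length of the cell that contains \<open>t\<close>.\<close>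

lemma discrepancy_le:
  assumes A: "A \<in> sets borel" "A \<subseteq> {0<..<1}" and t: "0 \<le> t" "t \<le> 1"
  shows "\<bar>measure lborel ((pre ^^ n) A \<inter> {..t}) - t * measure lborel A\<bar> \<le> contraction ^ n"
  using t
proof (induction n arbitrary: t)
  case 0
  have A1: "measure lborel A \<le> 1"
    using measure_mono_fmeasurable[of A "{0<..<1}" lborel] A by (simp add: fmeasurable_def)
  have "measure lborel (A \<inter> {..t}) \<le> measure lborel A"
    using A emeasure_unit_finite[of A] by (intro measure_mono_fmeasurable) (auto simp: fmeasurable_def)
  moreover have "t * measure lborel A \<le> 1"
    using A1 0 by (intro mult_le_one) auto
  moreover have "0 \<le> t * measure lborel A" using 0 by simp
  ultimately show ?case
    using A1 measure_nonneg[of lborel "A \<inter> {..t}"] by (simp only: abs_le_iff funpow_0 power_0) linarith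
next
  case (Suc n)
  let ?B = "(pre ^^ n) A"
  note B = iterated_pre[OF A, of n]
  show ?case
  proof (cases "t = 0")
    case True
    have "pre ?B \<inter> {..t} = {}" using pre_subset[of ?B] True by fastforce
    then show ?thesis using True contraction_bounds(1) by simp
  next
    case False
    with Suc.prems obtain k where k: "c (Suc k) < t" "t \<le> c k"
      using index_exists[of t] by auto
    define s where "s = branch k t"
    have s: "0 \<le> s" "s \<le> 1" "t = c (Suc k) + len k * s"
      using k len_pos[of k] by (auto simp: s_def branch_def len_def)
    have "t * measure lborel A = c (Suc k) * measure lborel A + len k * (s * measure lborel A)"
      by (subst s(3)) (simp add: algebra_simps)
    then have "measure lborel (pre ?B \<inter> {..t}) - t * measure lborel A =
        len k * (measure lborel (?B \<inter> {..s}) - s * measure lborel A)"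
      using measure_pre_step[OF B(1,2) k, folded s_def] by (simp add: B(3) right_diff_distrib)
    then have "\<bar>measure lborel (pre ?B \<inter> {..t}) - t * measure lborel A\<bar> =
        len k * \<bar>measure lborel (?B \<inter> {..s}) - s * measure lborel A\<bar>"
      using len_pos[of k] by (simp add: abs_mult)
    also have "\<dots> \<le> contraction * contraction ^ n"
      using contraction_bounds(1) contraction_bounds(3)[of k] Suc.IH[OF s(1,2)] len_pos[of k] by (intro mult_mono) auto
    finally show ?thesis by simp
  qed
qed


text \<open>The discrepancy estimate settles the half-lines; the sets B with the claimed limit form
  a Dynkin system, which extends it to all Borel sets.\<close>

lemma mixing_sets:
  assumes A: "A \<in> sets borel" "A \<subseteq> {0<..<1}" and B: "B \<in> sets borel"
  shows "(\<lambda>n. measure lborel (B \<inter> (pre ^^ n) A))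
    \<longlonglongrightarrow> measure lborel (B \<inter> {0<..<1}) * measure lborel A"
proof -
  note [measurable] = iterated_pre(1)[OF A]
  have fm: "S \<inter> {0<..<1} \<in> fmeasurable lborel" if "S \<in> sets borel" for S :: "real set"
    using that emeasure_unit_finite[of "S \<inter> {0<..<1}"] by (auto simp: fmeasurable_def)
  have fm2: "S \<inter> (pre ^^ n) A \<in> fmeasurable lborel" if "S \<in> sets borel" for S n
    using that emeasure_unit_finite[of "S \<inter> (pre ^^ n) A"] iterated_pre(1,2)[OF A, of n]
    by (auto simp: fmeasurable_def)
  have stable: "Int_stable (range (\<lambda>a::real. {..a}))"
    by (auto simp: Int_stable_def)
  have sub: "range (\<lambda>a::real. {..a}) \<subseteq> Pow UNIV" by simp
  have "sets borel = sigma_sets UNIV (range (\<lambda>a::real. {..a}))"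
    by (subst borel_eq_atMost) simp
  with B have "B \<in> sigma_sets UNIV (range (\<lambda>a::real. {..a}))" by simp
  then show ?thesis
  proof (induction rule: sigma_sets_induct_disjoint[OF stable sub, consumes 1, case_names basic empty compl union])
    case empty
    show ?case by simp
  next
    case (basic B)
    then obtain a :: real where a: "B = {..a}" by auto
    \<comment> \<open>Sets inside (0, 1) do not distinguish a from its truncation to [0, 1], where
      the discrepancy estimate applies.\<close>
    define t where "t = min 1 (max 0 a)"
    have t: "0 \<le> t" "t \<le> 1" by (auto simp: t_def)
    have 1: "B \<inter> S = S \<inter> {..t}" if "S \<subseteq> {0<..<1}" for S
      using that by (force simp: a t_def min_def max_def)
    have "{0<..<1} \<inter> {..t} = (if t = 1 then {0<..<1} else {0<..t})"
      using t by auto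
    then have 2: "measure lborel (B \<inter> {0<..<1}) = t"
      using t by (simp add: 1)
    have "(\<lambda>n. measure lborel ((pre ^^ n) A \<inter> {..t}) - t * measure lborel A) \<longlonglongrightarrow> 0"
    proof (rule Lim_null_comparison)
      show "\<forall>\<^sub>F n in sequentially. norm (measure lborel ((pre ^^ n) A \<inter> {..t}) - t * measure lborel A) \<le> contraction ^ n"
        using discrepancy_le[OF A t] by simp
      show "(\<lambda>n. contraction ^ n) \<longlonglongrightarrow> 0"
        using contraction_bounds by (intro LIMSEQ_realpow_zero) auto
    qed
    then show ?case
      by (subst 2, subst 1[OF iterated_pre(2)[OF A]]) (simp add: LIM_zero_iff)
  next
    case (compl B)
    then have [measurable]: "B \<in> sets borel" by (subst borel_eq_atMost) simp
    have 1: "measure lborel ((UNIV - B) \<inter> (pre ^^ n) A) = measure lborel A - measure lborel (B \<inter> (pre ^^ n) A)" for n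
    proof -
      have "(UNIV - B) \<inter> (pre ^^ n) A = (pre ^^ n) A - B \<inter> (pre ^^ n) A" by auto
      then show ?thesis
        using fm2[of UNIV n] fm2[of B n] iterated_pre(3)[OF A, of n]
        by (simp add: measurable_measure_Diff)
    qed
    have "(UNIV - B) \<inter> {0<..<1} = {0<..<1} - B \<inter> {0<..<1}" by auto
    then have 2: "measure lborel ((UNIV - B) \<inter> {0<..<1}) = 1 - measure lborel (B \<inter> {0<..<1})"
      using fm[of UNIV] fm[of B] by (simp add: measurable_measure_Diff)
    show ?case
      unfolding 1 2 left_diff_distrib mult_1 by (intro tendsto_intros compl)
  next
    case (union B)
    then have B [measurable]: "B i \<in> sets borel" for i by (subst borel_eq_atMost) auto
    have sums: "(\<lambda>i. measure lborel (B i \<inter> S)) sums measure lborel ((\<Union>i. B i) \<inter> S)"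
      if [measurable]: "S \<in> sets borel" and S: "S \<subseteq> {0<..<1}" for S
    proof -
      have "disjoint_family (\<lambda>i. B i \<inter> S)"
        using union(1) by (auto simp: disjoint_family_on_def)
      moreover have "emeasure lborel (\<Union>i. B i \<inter> S) \<noteq> \<infinity>"
        using emeasure_unit_finite[of "\<Union>i. B i \<inter> S"] S by (auto simp: less_top[symmetric])
      ultimately have "(\<lambda>i. measure lborel (B i \<inter> S)) sums measure lborel (\<Union>i. B i \<inter> S)"
        by (intro measure_UNION) auto
      moreover have "(\<Union>i. B i \<inter> S) = (\<Union>i. B i) \<inter> S" by auto
      ultimately show ?thesis by simp
    qed
    \<comment> \<open>Exchange of limit and sum: the terms are dominated, uniformly in n, by the
      lengths of the \<open>B i\<close> inside (0, 1), because iterated preimages stay in (0,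
      1).\<close>
    have "(\<lambda>n. \<Sum>i. measure lborel (B i \<inter> (pre ^^ n) A))
      \<longlonglongrightarrow> (\<Sum>i. measure lborel (B i \<inter> {0<..<1}) * measure lborel A)"
    proof (rule tannerys_theorem[where M = "\<lambda>i. measure lborel (B i \<inter> {0<..<1})", THEN conjunct2, THEN conjunct2])
      show "summable (\<lambda>i. measure lborel (B i \<inter> {0<..<1}))"
        using sums[of "{0<..<1}"] by (auto simp: sums_iff)
      show "\<forall>\<^sub>F (i, n) in at_top \<times>\<^sub>F sequentially.
          norm (measure lborel (B i \<inter> (pre ^^ n) A)) \<le> measure lborel (B i \<inter> {0<..<1})"
        using iterated_pre(2)[OF A] fm[of "B _"] fm2[of "B _"]
        by (intro always_eventually) (auto intro!: measure_mono_fmeasurable)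
    qed (use union(3) in auto)
    also have "(\<lambda>n. \<Sum>i. measure lborel (B i \<inter> (pre ^^ n) A)) =
        (\<lambda>n. measure lborel ((\<Union>i. B i) \<inter> (pre ^^ n) A))"
      using sums iterated_pre(1,2)[OF A] by (simp add: sums_iff fun_eq_iff)
    also have "(\<Sum>i. measure lborel (B i \<inter> {0<..<1}) * measure lborel A) =
        measure lborel ((\<Union>i. B i) \<inter> {0<..<1}) * measure lborel A"
      using sums_mult2[OF sums[of "{0<..<1}"]] by (simp add: sums_iff)
    finally show ?case .
  qed
qed

text \<open>Multiples of indicators reduce to \<open>mixing_sets\<close>. The passage to the limit
  works because integration over any set is 1-Lipschitz in the L1 norm, so one approximant of f is
  good for all n at once.\<close>

lemma mixing_integrable:
  fixes f :: "real \<Rightarrow> real"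
  assumes A: "A \<in> sets borel" "A \<subseteq> {0<..<1}" and f: "integrable lborel f"
  shows "(\<lambda>n. \<integral>x. f x * indicator ((pre ^^ n) A) x \<partial>lborel)
    \<longlonglongrightarrow> (\<integral>x. f x * indicator {0<..<1} x \<partial>lborel) * measure lborel A"
  using f
proof (induct rule: integrable_induct)
  case (base B k)
  have eq: "(\<integral>x. (indicator B x *\<^sub>R k) * indicator S x \<partial>lborel) = k * measure lborel (B \<inter> S)"
    for S :: "real set"
    by (simp add: indicator_inter_arith[symmetric] mult_ac)
  show ?case
    unfolding eq mult.assoc using base A by (intro tendsto_intros mixing_sets) auto
next
  case (add f g)
  have eq: "(\<integral>x. (f x + g x) * indicator S x \<partial>lborel) =
      (\<integral>x. f x * indicator S x \<partial>lborel) + (\<integral>x. g x * indicator S x \<partial>lborel)"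
    if "S \<in> sets borel" for S
    unfolding distrib_right using that add(1,3)
    by (intro Bochner_Integration.integral_add integrable_real_mult_indicator) auto
  show ?case
    unfolding eq[OF iterated_pre(1)[OF A]] eq[OF borel_open[OF open_greaterThanLessThan]]
    using tendsto_add[OF add(2,4)] by (simp only: distrib_right)
next
  case (lim f s)
  define \<Lambda> where "\<Lambda> S g = (\<integral>x. g x * indicator S x \<partial>lborel)" for S :: "real set" and g :: "real \<Rightarrow> real"
  have lip: "\<bar>\<Lambda> S f - \<Lambda> S (s i)\<bar> \<le> (\<integral>x. \<bar>f x - s i x\<bar> \<partial>lborel)" if "S \<in> sets borel" for S i
  proof -
    have "\<Lambda> S f - \<Lambda> S (s i) = (\<integral>x. (f x - s i x) * indicator S x \<partial>lborel)"
      using that lim by (simp add: \<Lambda>_def left_diff_distrib integrable_real_mult_indicator)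
    also have "\<bar>\<dots>\<bar> \<le> (\<integral>x. \<bar>(f x - s i x) * indicator S x\<bar> \<partial>lborel)"
      by (rule integral_abs_bound)
    also have "\<dots> \<le> (\<integral>x. \<bar>f x - s i x\<bar> \<partial>lborel)"
    proof (rule integral_mono)
      show "integrable lborel (\<lambda>x. \<bar>(f x - s i x) * indicator S x\<bar>)"
        using that lim(1,5) by (intro integrable_abs integrable_real_mult_indicator) auto
    qed (use lim(1,5) in \<open>auto simp: indicator_def\<close>)
    finally show ?thesis .
  qed
  have "(\<lambda>i. \<integral>x. \<bar>f x - s i x\<bar> \<partial>lborel) \<longlonglongrightarrow> (\<integral>x. \<bar>f x - f x\<bar> \<partial>lborel)"
  proof (rule integral_dominated_convergence[where w = "\<lambda>x. 3 * \<bar>f x\<bar>"])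
    show "AE x in lborel. (\<lambda>i. \<bar>f x - s i x\<bar>) \<longlonglongrightarrow> \<bar>f x - f x\<bar>"
      using lim(3) by (intro AE_I2 tendsto_intros) auto
    \<comment> \<open>The approximants supplied by the induction rule are bounded by
      \<open>2 * \<bar>f x\<bar>\<close>; hence the factor 3.\<close>
    have "\<bar>f x - s i x\<bar> \<le> 3 * \<bar>f x\<bar>" for x i
      using lim(4)[of x i] by simp
    then show "AE x in lborel. norm \<bar>f x - s i x\<bar> \<le> 3 * \<bar>f x\<bar>" for i by simp
  qed (use lim in auto)
  then have L1: "(\<lambda>i. \<integral>x. \<bar>f x - s i x\<bar> \<partial>lborel) \<longlonglongrightarrow> 0" by simp
  have A1: "measure lborel A \<le> 1"
    using measure_mono_fmeasurable[of A "{0<..<1}" lborel] A by (simp add: fmeasurable_def)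
  have "(\<lambda>n. \<Lambda> ((pre ^^ n) A) f) \<longlonglongrightarrow> \<Lambda> {0<..<1} f * measure lborel A"
  proof (rule LIMSEQ_I)
    fix e :: real assume "e > 0"
    then obtain i where i: "(\<integral>x. \<bar>f x - s i x\<bar> \<partial>lborel) < e / 3"
      using order_tendstoD(2)[OF L1, of "e / 3"] by (auto simp: eventually_sequentially)
    have "(\<lambda>n. \<Lambda> ((pre ^^ n) A) (s i)) \<longlonglongrightarrow> \<Lambda> {0<..<1} (s i) * measure lborel A"
      using lim(2) by (simp add: \<Lambda>_def)
    from LIMSEQ_D[OF this, of "e / 3"] \<open>e > 0\<close> obtain N where
      N: "\<And>n. n \<ge> N \<Longrightarrow> \<bar>\<Lambda> ((pre ^^ n) A) (s i) - \<Lambda> {0<..<1} (s i) * measure lborel A\<bar> < e / 3"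
      by auto
    have "\<bar>\<Lambda> {0<..<1} f * measure lborel A - \<Lambda> {0<..<1} (s i) * measure lborel A\<bar> =
        \<bar>\<Lambda> {0<..<1} f - \<Lambda> {0<..<1} (s i)\<bar> * measure lborel A"
      by (simp add: abs_mult left_diff_distrib[symmetric])
    also have "\<dots> \<le> \<bar>\<Lambda> {0<..<1} f - \<Lambda> {0<..<1} (s i)\<bar>"
      using A1 by (simp add: mult_left_le)
    also have "\<dots> < e / 3" using lip[of "{0<..<1}" i] i by simp
    finally have 1: "\<bar>\<Lambda> {0<..<1} f * measure lborel A - \<Lambda> {0<..<1} (s i) * measure lborel A\<bar> < e / 3" .
    have "\<bar>\<Lambda> ((pre ^^ n) A) f - \<Lambda> {0<..<1} f * measure lborel A\<bar> < e" if "n \<ge> N" for n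
      using 1 N[OF that] lip[OF iterated_pre(1)[OF A, of n], of i] i by linarith
    then show "\<exists>N. \<forall>n\<ge>N. norm (\<Lambda> ((pre ^^ n) A) f - \<Lambda> {0<..<1} f * measure lborel A) < e"
      by auto
  qed
  then show ?case by (simp add: \<Lambda>_def)
qed

text \<open>By invariance the measures of the iterated preimages of A form a constant sequence;
  mixing, applied to the density of \<nu>, computes its limit.\<close>

lemma pre_invariant_measure_unique:
  assumes "finite_measure \<nu>" and sets_\<nu>: "sets \<nu> = sets borel" and ac: "absolutely_continuous lborel \<nu>"
    and inv: "\<And>B. B \<in> sets borel \<Longrightarrow> B \<subseteq> {0<..<1} \<Longrightarrow> measure \<nu> (pre B) = measure \<nu> B"
    and A: "A \<in> sets borel" "A \<subseteq> {0<..<1}"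
  shows "measure \<nu> A = measure \<nu> {0<..<1} * measure lborel A"
proof -
  interpret finite_measure \<nu> by fact
  obtain D where D [measurable]: "D \<in> borel_measurable lborel"
    and D_eq: "AE x in lborel. RN_deriv lborel \<nu> x = ennreal (D x)" and D_nonneg: "\<And>x. 0 \<le> D x"
    using sigma_finite_measure.real_RN_deriv[OF sigma_finite_lborel assms(1) ac] sets_\<nu>
    by (metis sets_lborel)
  have "density lborel (RN_deriv lborel \<nu>) = \<nu>"
    using sigma_finite_measure.density_RN_deriv[OF sigma_finite_lborel ac] sets_\<nu> by simp
  then have dens: "\<nu> = density lborel (\<lambda>x. ennreal (D x))"
    using density_cong[OF _ _ D_eq] by simp
  \<comment> \<open>Finiteness of \<nu>, read through the density, is the integrability that mixing
    asks for.\<close>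
  have "integrable \<nu> (\<lambda>_. 1 :: real)" by simp
  then have int: "integrable lborel D"
    using D_nonneg by (subst (asm) dens, subst (asm) integrable_density) auto
  have meas: "measure \<nu> S = (\<integral>x. D x * indicator S x \<partial>lborel)" if S [measurable]: "S \<in> sets borel" for S
  proof -
    have "measure \<nu> S = (\<integral>x. indicator S x \<partial>\<nu>)" using sets_\<nu> by simp
    also have "\<dots> = (\<integral>x. D x *\<^sub>R indicator S x \<partial>lborel)"
      using D_nonneg by (subst dens, subst integral_density) auto
    finally show ?thesis by simp
  qed
  have "measure \<nu> ((pre ^^ n) A) = measure \<nu> A" for n
    by (induction n) (simp_all add: inv iterated_pre[OF A])
  then have "(\<lambda>n. measure \<nu> A) \<longlonglongrightarrow> measure \<nu> {0<..<1} * measure lborel A"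
    using mixing_integrable[OF A int] iterated_pre(1)[OF A] by (simp add: meas[symmetric])
  then show ?thesis by (rule LIMSEQ_unique[OF tendsto_const])
qed

end

subsection \<open>The invariant density\<close>

locale gaspard_wang =
  fixes p :: real and T :: "real \<Rightarrow> real" and \<mu> :: "real measure"
  assumes p_less: "p < -1" and gw_map: "gaspard_wang_map p T" and acip_mu: "acip T \<mu>"
begin

sublocale interval_chain "gw_c p"
proof
  show "gw_c p 0 = 1" by (simp add: gw_c_def)
  show "gw_c p (Suc k) < gw_c p k" for k
    using p_less by (simp add: gw_c_def powr_less_mono2_neg)
  have "filterlim (\<lambda>j. real (j + 1)) at_top sequentially"
    by (intro filterlim_compose[OF filterlim_real_sequentially] filterlim_add_const_nat_at_top)
  then show "gw_c p \<longlonglongrightarrow> 0"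
    unfolding gw_c_def using p_less by (intro tendsto_neg_powr) auto
qed

section \<open>Action of the map on the cells\<close>

lemma gw_I_eq_cell: "gw_I p k = cell k"
  by (simp add: gw_I_def cell_def)

lemma gw_l_eq_len: "gw_l p (int k) = len k"
  by (simp add: gw_l_def len_def nat_add_distrib)

lemma T_on_cell:
  assumes "x \<in> cell k"
  shows "T x = (x - gw_c p (Suc k)) * (gw_l p (int k - 1) / len k) + gw_d p k"
  using gw_map assms by (auto simp: gaspard_wang_map_def gw_I_eq_cell gw_l_eq_len)

text \<open>The conventions for l at index -1 and d at index 0 are what make this branch
  full.\<close>

lemma T_cell_0: "x \<in> cell 0 \<Longrightarrow> T x = branch 0 x"
  using T_on_cell[of x 0] by (simp add: gw_l_def gw_d_def branch_def)

text \<open>A point keeps its relative position in its cell while it descends towards I_0.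
  Consequently the \<open>T\<close>-preimage of \<open>piece k S\<close> inside I_(k+1) is again a
  piece with the same S.\<close>

lemma branch_T:
  assumes "x \<in> cell (Suc k)"
  shows "branch k (T x) = branch (Suc k) x"
proof -
  have "T x = branch (Suc k) x * len k + gw_c p (Suc k)"
    using T_on_cell[OF assms] by (simp add: gw_l_eq_len gw_d_def branch_def)
  then show ?thesis using len_pos[of k] by (simp add: branch_def[of k])
qed

lemma T_cell_Suc: "x \<in> cell (Suc k) \<Longrightarrow> T x \<in> cell k"
  by (metis branch_T branch_in_unit_iff)

section \<open>The invariant measure on the cells\<close>

lemma sets_mu: "sets \<mu> = sets (restrict_space borel {0..1})"
  and prob_space_mu: "prob_space \<mu>"
  and ac_mu: "absolutely_continuous (restrict_space lborel {0..1}) \<mu>"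
  and T_measurable: "T \<in> measurable \<mu> \<mu>"
  and distr_T: "distr \<mu> \<mu> T = \<mu>"
  using acip_mu by (auto simp: acip_def phase_space_def)

sublocale prob_space \<mu>
  by (rule prob_space_mu)

lemma space_mu: "space \<mu> = {0..1}"
  using sets_eq_imp_space_eq[OF sets_mu] by (simp add: space_restrict_space)

lemma sets_muI: "B \<in> sets borel \<Longrightarrow> B \<subseteq> {0..1} \<Longrightarrow> B \<in> sets \<mu>"
  by (simp add: sets_mu sets_restrict_space_iff)

lemma borel_measurable_mu: "f \<in> borel_measurable borel \<Longrightarrow> f \<in> borel_measurable \<mu>"
  using measurable_restrict_space1[of f borel borel "{0..1}"] measurable_cong_sets[OF sets_mu] by blast

lemma measure_T_vimage: "B \<in> sets \<mu> \<Longrightarrow> measure \<mu> (T -` B \<inter> {0..1}) = measure \<mu> B"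
  using measure_distr[OF T_measurable, of B] by (simp add: distr_T space_mu)

lemma mu_null: "B \<in> sets borel \<Longrightarrow> B \<subseteq> {0..1} \<Longrightarrow> emeasure lborel B = 0 \<Longrightarrow> emeasure \<mu> B = 0"
  using absolutely_continuousD[OF ac_mu, of B]
  by (simp add: emeasure_restrict_space sets_restrict_space_iff)

lemma cell_subset_closed: "cell k \<subseteq> {0..1}"
  using cell_subset[of k] by auto

lemma piece_sets_mu [measurable, simp]: "B \<in> sets borel \<Longrightarrow> piece k B \<in> sets \<mu>"
  using piece_subset_cell[of k B] cell_subset_closed[of k] by (intro sets_muI) auto

lemma endpoints_null: "{0..1} - (\<Union>k. cell k) \<in> null_sets \<mu>"
proof (rule null_setsI)
  have "countable ({0..1} - (\<Union>k. cell k))"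
  proof (rule countable_subset)
    show "{0..1} - (\<Union>k. cell k) \<subseteq> insert 0 (range (gw_c p))"
    proof
      fix x :: real assume x: "x \<in> {0..1} - (\<Union>k. cell k)"
      then have "x \<notin> {0<..1} - range (gw_c p)" using cell_cover by blast
      with x show "x \<in> insert 0 (range (gw_c p))" by auto
    qed
  qed simp
  then have "emeasure lborel ({0..1} - (\<Union>k. cell k)) = 0"
    by (rule emeasure_lborel_countable)
  then show "emeasure \<mu> ({0..1} - (\<Union>k. cell k)) = 0"
    by (intro mu_null) auto
  show "{0..1} - (\<Union>k. cell k) \<in> sets \<mu>"
    by (intro sets_muI) auto
qed

lemma AE_cell: "AE x in \<mu>. \<exists>k. x \<in> cell k"
  by (rule AE_I'[OF endpoints_null]) (auto simp: space_mu)

text \<open>Up to endpoints, the \<open>T\<close>-preimage of \<open>piece k S\<close> has two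
  parts: one in I_0, where \<open>T\<close> is the full branch, and one in I_(k+1), where the
  coordinate is preserved. Invariance of \<mu> equates the masses.\<close>

lemma measure_piece_Suc:
  assumes S [measurable]: "S \<in> sets borel"
  shows "measure \<mu> (piece k S) = measure \<mu> (piece 0 (piece k S)) + measure \<mu> (piece (Suc k) S)"
proof -
  have "measure \<mu> (piece k S) = measure \<mu> (T -` piece k S \<inter> {0..1})"
    by (simp add: measure_T_vimage)
  also have "\<dots> = measure \<mu> (piece 0 (piece k S) \<union> piece (Suc k) S)"
  proof (rule finite_measure_eq_AE)
    have "x \<in> T -` piece k S \<inter> {0..1} \<longleftrightarrow> x \<in> piece 0 (piece k S) \<union> piece (Suc k) S"
      if x: "x \<in> cell j" for x j
    proof (cases j)
      case 0
      then show ?thesis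
        using x T_cell_0[of x] cell_subset_closed[of 0] cell_disjoint[of 0 "Suc k"]
        by (auto simp: piece_def)
    next
      case (Suc i)
      have "x \<notin> cell 0" using x Suc cell_disjoint[of j 0] by auto
      moreover have "x \<in> piece (Suc k) S \<longleftrightarrow> T x \<in> piece k S"
      proof (cases "i = k")
        case True
        then show ?thesis
          using x Suc T_cell_Suc[of x i] branch_T[of x i] by (auto simp: piece_def)
      next
        case False
        then show ?thesis
          using x Suc T_cell_Suc[of x i] cell_disjoint[of i k] cell_disjoint[of j "Suc k"]
          by (auto simp: piece_def)
      qed
      ultimately show ?thesis
        using x cell_subset_closed[of j] by (auto simp: piece_def)
    qed
    then show "AE x in \<mu>. x \<in> T -` piece k S \<inter> {0..1} \<longleftrightarrow> x \<in> piece 0 (piece k S) \<union> piece (Suc k) S"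
      by (intro eventually_mono[OF AE_cell]) blast
    show "T -` piece k S \<inter> {0..1} \<in> sets \<mu>"
      using measurable_sets[OF T_measurable, of "piece k S"] by (simp add: space_mu)
  qed auto
  also have "\<dots> = measure \<mu> (piece 0 (piece k S)) + measure \<mu> (piece (Suc k) S)"
    using cell_disjoint[of 0 "Suc k"] piece_subset_cell[of 0 "piece k S"] piece_subset_cell[of "Suc k" S]
    by (intro finite_measure_Union) auto
  finally show ?thesis .
qed

lemma measure_piece_tendsto_0:
  assumes "S \<in> sets borel"
  shows "(\<lambda>k. measure \<mu> (piece k S)) \<longlonglongrightarrow> 0"
proof -
  have "(\<lambda>k. measure \<mu> (piece k S)) sums measure \<mu> (\<Union>k. piece k S)"
    using assms disjoint_family_piece by (intro finite_measure_UNION) auto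
  then show ?thesis by (intro summable_LIMSEQ_zero) (auto simp: sums_iff)
qed

text \<open>The previous relation telescopes, with no mass left at infinity. For k = 0 this is the
  invariance of the rescaled measure on I_0; for general k it expresses \<mu> on I_k through its
  values on I_0.\<close>

lemma measure_piece_sums:
  assumes "S \<in> sets borel"
  shows "(\<lambda>i. measure \<mu> (piece 0 (piece (k + i) S))) sums measure \<mu> (piece k S)"
proof -
  have "(\<lambda>i. measure \<mu> (piece (k + i) S)) \<longlonglongrightarrow> 0"
    using LIMSEQ_ignore_initial_segment[OF measure_piece_tendsto_0[OF assms], of k]
    by (simp add: add.commute)
  then have tele: "(\<lambda>i. measure \<mu> (piece (k + i) S) - measure \<mu> (piece (k + Suc i) S)) sums measure \<mu> (piece k S)"
    using telescope_sums' by fastforce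
  have "measure \<mu> (piece (k + i) S) - measure \<mu> (piece (k + Suc i) S) = measure \<mu> (piece 0 (piece (k + i) S))" for i
    using measure_piece_Suc[OF assms, of "k + i"] by simp
  with tele show ?thesis by (simp only:)
qed

definition mass :: real where
  "mass = measure \<mu> (cell 0)"

lemma piece_unit: "piece k {0<..<1} = cell k"
  using branch_in_unit_iff by (auto simp: piece_def)

text \<open>The image of \<open>\<mu>\<close> restricted to \<open>I\<^sub>0\<close> under the full branch of \<open>T\<close> is invariant
  under the map sending every cell affinely onto \<open>(0, 1)\<close>: this is the first return map to
  \<open>I\<^sub>0\<close>, transported to \<open>(0, 1)\<close>.\<close>

lemma measure_piece_0:
  assumes A: "A \<in> sets borel" "A \<subseteq> {0<..<1}"
  shows "measure \<mu> (piece 0 A) = mass * measure lborel A"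
proof -
  have cell_0: "cell 0 \<inter> space \<mu> \<in> sets \<mu>"
    by (intro sets.Int sets_muI cell_subset_closed sets.top cell_borel)
  have sp: "space (restrict_space \<mu> (cell 0)) = cell 0"
    using cell_subset_closed[of 0] by (auto simp: space_restrict_space space_mu)
  define \<nu> where "\<nu> = distr (restrict_space \<mu> (cell 0)) borel (branch 0)"
  have br: "branch 0 \<in> measurable (restrict_space \<mu> (cell 0)) borel"
    by (intro measurable_restrict_space1 borel_measurable_mu) measurable
  have em: "emeasure \<nu> B = emeasure \<mu> (piece 0 B)" if [measurable]: "B \<in> sets borel" for B
  proof -
    have "branch 0 -` B \<inter> cell 0 = piece 0 B" by (auto simp: piece_def)
    then show ?thesis
      using br cell_0 piece_subset_cell[of 0 B]
      by (simp add: \<nu>_def emeasure_distr sp emeasure_restrict_space)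
  qed
  then have meas: "measure \<nu> B = measure \<mu> (piece 0 B)" if "B \<in> sets borel" for B
    using that by (simp add: measure_def)
  have fin: "finite_measure \<nu>"
  proof
    have "emeasure \<nu> UNIV \<noteq> \<infinity>" by (simp add: em)
    then show "emeasure \<nu> (space \<nu>) \<noteq> \<infinity>" by (simp add: \<nu>_def)
  qed
  have ac: "absolutely_continuous lborel \<nu>"
    unfolding absolutely_continuous_def
  proof
    fix N :: "real set" assume "N \<in> null_sets lborel"
    then have N [measurable]: "N \<in> sets borel" "emeasure lborel N = 0" by auto
    have [measurable]: "branch 0 -` N \<in> sets borel"
      using measurable_sets[OF branch_measurable N(1)] by simp
    have "emeasure lborel (piece 0 N) \<le> emeasure lborel (branch 0 -` N)"
      by (intro emeasure_mono) (auto simp: piece_def)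
    also have "\<dots> = 0" using N by (simp add: emeasure_branch_vimage)
    finally have "emeasure \<mu> (piece 0 N) = 0"
      using piece_subset_cell[of 0 N] cell_subset_closed[of 0] by (intro mu_null) auto
    then show "N \<in> null_sets \<nu>" using em[OF N(1)] N(1) by (auto simp: \<nu>_def)
  qed
  have inv: "measure \<nu> (pre B) = measure \<nu> B" if B [measurable]: "B \<in> sets borel" for B
  proof -
    interpret \<nu>: finite_measure \<nu> by fact
    have "(\<lambda>k. measure \<nu> (piece k B)) sums measure \<nu> (pre B)"
      unfolding pre_def using disjoint_family_piece[of B]
      by (intro \<nu>.finite_measure_UNION) (auto simp: \<nu>_def)
    moreover have "(\<lambda>k. measure \<nu> (piece k B)) sums measure \<nu> B"
      using measure_piece_sums[OF B, of 0] by (simp add: meas)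
    ultimately show ?thesis by (rule sums_unique2)
  qed
  have "measure \<nu> A = measure \<nu> {0<..<1} * measure lborel A"
    by (intro pre_invariant_measure_unique[OF fin _ ac inv] A) (auto simp: \<nu>_def)
  then show ?thesis using A by (simp add: meas mass_def piece_unit)
qed

text \<open>The mass over I_k is collected from the parts of I_0 thrown into I_k, I_(k+1) and so on.
  Their rescaled lengths are the cell lengths, which telescope to \<open>gw_c p k\<close>.\<close>

lemma measure_piece:
  assumes S: "S \<in> sets borel" "S \<subseteq> {0<..<1}"
  shows "measure \<mu> (piece k S) = mass * gw_c p k * measure lborel S"
proof -
  have "measure \<mu> (piece 0 (piece j S)) = mass * (len j * measure lborel S)" for j
    using S emeasure_piece[OF S, of j] len_pos[of j]
      piece_subset_cell[of j S] cell_subset[of j]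
    by (subst measure_piece_0) (auto simp: measure_def enn2real_mult less_imp_le)
  then have "(\<lambda>i. mass * (len (k + i) * measure lborel S)) sums measure \<mu> (piece k S)"
    using measure_piece_sums[OF S(1), of k] by simp
  moreover have "(\<lambda>i. mass * (len (k + i) * measure lborel S)) sums (mass * (gw_c p k * measure lborel S))"
    by (intro sums_mult sums_mult2 len_sums)
  ultimately show ?thesis by (metis sums_unique2 mult.assoc)
qed

lemma measure_cell: "measure \<mu> (cell k) = mass * gw_c p k"
  using measure_piece[of "{0<..<1}" k] by (simp add: piece_unit)

text \<open>If I_0 were null, the formula for the cells would make all of them null, leaving nothing
  for the total mass 1.\<close>

lemma mass_pos: "mass > 0"
proof (rule ccontr)
  assume "\<not> mass > 0"
  then have "mass = 0" using measure_nonneg[of \<mu> "cell 0"] unfolding mass_def by linarith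
  then have "emeasure \<mu> (cell k) = 0" for k
    using measure_cell[of k] by (simp add: emeasure_eq_measure)
  then have "cell k \<in> null_sets \<mu>" for k
    using cell_subset_closed[of k] by (intro null_setsI sets_muI) auto
  then have "AE x in \<mu>. x \<notin> cell k" for k by (rule AE_not_in)
  then have "AE x in \<mu>. \<forall>k. x \<notin> cell k" by (simp add: AE_all_countable)
  with AE_cell have "AE x in \<mu>. False" by eventually_elim blast
  then show False using AE_False by blast
qed

section \<open>The density with respect to Lebesgue measure\<close>

definition dens :: "real \<Rightarrow> ennreal" where
  "dens x = (\<Sum>k. ennreal (mass * gw_c p k / len k) * indicator (cell k) x)"

lemma dens_cell: "x \<in> cell k \<Longrightarrow> dens x = ennreal (mass * gw_c p k / len k)"
  unfolding dens_def by (rule suminf_cmult_indicator[OF disjoint_family_cell])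

lemma dens_measurable [measurable]: "dens \<in> borel_measurable borel"
  unfolding dens_def by measurable

lemma emeasure_Int_cell:
  assumes [measurable]: "B \<in> sets borel"
  shows "emeasure \<mu> (B \<inter> cell k) = ennreal (mass * gw_c p k / len k) * emeasure lborel (B \<inter> cell k)"
proof -
  \<comment> \<open>The set B in the coordinate of cell k, chosen so that \<open>piece k S\<close>
    is \<open>B \<inter> cell k\<close>.\<close>
  define S where "S = (\<lambda>y. gw_c p (Suc k) + len k * y) -` (B \<inter> cell k)"
  have "(\<lambda>y. gw_c p (Suc k) + len k * y) \<in> borel_measurable borel" by measurable
  from measurable_sets[OF this, of "B \<inter> cell k"] have S [measurable]: "S \<in> sets borel"
    by (simp add: S_def)
  have inv: "gw_c p (Suc k) + len k * branch k x = x" for x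
    using len_pos[of k] by (simp add: branch_def)
  have sub: "S \<subseteq> {0<..<1}"
  proof
    fix y assume "y \<in> S"
    then have "gw_c p (Suc k) + len k * y \<in> cell k" by (simp add: S_def)
    then have "branch k (gw_c p (Suc k) + len k * y) \<in> {0<..<1}"
      by (simp add: branch_in_unit_iff del: greaterThanLessThan_iff)
    then show "y \<in> {0<..<1}" using len_pos[of k] by (simp add: branch_def)
  qed
  have eq: "piece k S = B \<inter> cell k"
    by (auto simp: piece_def S_def inv)
  have fin: "emeasure lborel S = ennreal (measure lborel S)"
    using emeasure_unit_finite[OF sub] by (simp add: emeasure_eq_ennreal_measure)
  have "emeasure \<mu> (piece k S) = ennreal (mass * gw_c p k * measure lborel S)"
    by (simp add: emeasure_eq_measure measure_piece[OF S sub])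
  also have "\<dots> = ennreal (mass * gw_c p k / len k) * (ennreal (len k) * ennreal (measure lborel S))"
    using len_pos[of k] mass_pos c_pos[of k] by (simp add: ennreal_mult[symmetric] less_imp_le)
  also have "\<dots> = ennreal (mass * gw_c p k / len k) * emeasure lborel (piece k S)"
    by (simp add: emeasure_piece[OF S sub] fin)
  finally show ?thesis by (simp add: eq)
qed

text \<open>\<mu> lives on the subspace [0, 1]; pushing it forward along the identity makes it a
  measure on the line, where it can be compared with a density of \<open>lborel\<close>.\<close>

lemma distr_mu_eq_density: "distr \<mu> borel (\<lambda>x. x) = density lborel dens"
proof (rule measure_eqI)
  fix B :: "real set" assume "B \<in> sets (distr \<mu> borel (\<lambda>x. x))"
  then have [measurable]: "B \<in> sets borel" by simp
  have B_cell: "B \<inter> cell k \<in> sets \<mu>" for k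
    using cell_subset_closed[of k] by (intro sets_muI) auto
  have "emeasure (distr \<mu> borel (\<lambda>x. x)) B = emeasure \<mu> (B \<inter> {0..1})"
    by (subst emeasure_distr) (auto intro: borel_measurable_mu simp: space_mu)
  also have "\<dots> = emeasure \<mu> (\<Union>k. B \<inter> cell k)"
  proof (rule emeasure_eq_AE)
    show "AE x in \<mu>. x \<in> B \<inter> {0..1} \<longleftrightarrow> x \<in> (\<Union>k. B \<inter> cell k)"
      using AE_cell AE_space by eventually_elim (auto simp: space_mu)
    show "(\<Union>k. B \<inter> cell k) \<in> sets \<mu>" using B_cell by blast
  qed (auto intro: sets_muI)
  also have "\<dots> = (\<Sum>k. emeasure \<mu> (B \<inter> cell k))"
    using B_cell disjoint_family_cell
    by (intro suminf_emeasure[symmetric]) (auto simp: disjoint_family_on_def)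
  also have "\<dots> = (\<Sum>k. \<integral>\<^sup>+x. ennreal (mass * gw_c p k / len k) * indicator (cell k) x * indicator B x \<partial>lborel)"
    by (simp add: emeasure_Int_cell mult.assoc nn_integral_cmult indicator_inter_arith[symmetric] Int_commute)
  also have "\<dots> = (\<integral>\<^sup>+x. (\<Sum>k. ennreal (mass * gw_c p k / len k) * indicator (cell k) x * indicator B x) \<partial>lborel)"
    by (subst nn_integral_suminf) auto
  also have "\<dots> = emeasure (density lborel dens) B"
    by (subst emeasure_density) (auto simp: dens_def)
  finally show "emeasure (distr \<mu> borel (\<lambda>x. x)) B = emeasure (density lborel dens) B" .
qed simp

lemma nn_integral_mu:
  assumes [measurable]: "f \<in> borel_measurable borel"
  shows "(\<integral>\<^sup>+x. f x \<partial>\<mu>) = (\<integral>\<^sup>+x. dens x * f x \<partial>lborel)"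
proof -
  have "(\<integral>\<^sup>+x. f x \<partial>\<mu>) = (\<integral>\<^sup>+x. f x \<partial>(distr \<mu> borel (\<lambda>x. x)))"
    by (subst nn_integral_distr) (auto intro: borel_measurable_mu)
  also have "\<dots> = (\<integral>\<^sup>+x. dens x * f x \<partial>lborel)"
    by (simp add: distr_mu_eq_density nn_integral_density)
  finally show ?thesis .
qed

end

subsection \<open>Return times\<close>

text \<open>This covers a point that never returns (y infinite); y = 0 forces k = 0, where the
  convention \<open>0 powr a = 0\<close> agrees with the claim.\<close>

lemma epowr_ge_of_nat:
  assumes "0 < a" "of_nat k \<le> y"
  shows "ennreal (real k powr a) \<le> epowr y a"
proof (cases "y = 0 \<or> y = \<infinity>")
  case True
  then show ?thesis using assms by (auto simp: epowr_def)
next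
  case False
  then have "ennreal (real k) \<le> ennreal (enn2real y)"
    using assms(2) by (simp add: less_top ennreal_of_nat_eq_real_of_nat)
  then have "real k \<le> enn2real y" by simp
  with assms(1) False show ?thesis
    by (auto simp: epowr_def intro!: ennreal_leI powr_mono2)
qed

text \<open>For both orientations some cell contains a right neighbourhood of t, and a cell of
  length \<epsilon> reaching past t cannot extend below t - \<epsilon>.\<close>

lemma grid_cell_at:
  fixes a s \<epsilon> t :: real
  assumes s: "s \<in> {-1, 1}" and \<epsilon>: "\<epsilon> > 0" and t: "0 \<le> t" "t < 1"
  obtains k \<delta> where "\<delta> > 0" "{t<..<t + \<delta>} \<subseteq> grid_cell a s \<epsilon> k" "grid_cell a s \<epsilon> k \<subseteq> {t - \<epsilon>..}"
proof -
  have phase: "{t<..<t + \<delta>} \<subseteq> phase_space" if "\<delta> \<le> 1 - t" for \<delta>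
    using that t by (auto simp: phase_space_def)
  show thesis
  proof (cases "s = 1")
    case True
    define k where "k = \<lfloor>(t - a) / \<epsilon>\<rfloor>"
    have "of_int k \<le> (t - a) / \<epsilon>" "(t - a) / \<epsilon> < of_int k + 1"
      by (auto simp: k_def)
    then have k: "a + of_int k * \<epsilon> \<le> t" "t < a + (of_int k + 1) * \<epsilon>"
      using \<epsilon> by (auto simp: field_simps)
    have eq: "grid_cell a s \<epsilon> k = {a + of_int k * \<epsilon>..<a + (of_int k + 1) * \<epsilon>} \<inter> phase_space"
    proof -
      have "x \<in> (\<lambda>t. a + s * t) ` {of_int k * \<epsilon>..<(of_int k + 1) * \<epsilon>}"
        if "x \<in> {a + of_int k * \<epsilon>..<a + (of_int k + 1) * \<epsilon>}" for x
        using that True by (intro image_eqI[of _ _ "x - a"]) auto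
      then show ?thesis using True by (auto simp: grid_cell_def)
    qed
    define \<delta> where "\<delta> = min (1 - t) (a + (of_int k + 1) * \<epsilon> - t)"
    have \<delta>: "\<delta> \<le> 1 - t" "\<delta> \<le> a + (of_int k + 1) * \<epsilon> - t" "\<delta> > 0"
      using k t by (auto simp: \<delta>_def)
    show thesis
    proof (rule that[of \<delta> k])
      show "{t<..<t + \<delta>} \<subseteq> grid_cell a s \<epsilon> k"
        using phase[OF \<delta>(1)] \<delta>(2) k unfolding eq by auto
      show "grid_cell a s \<epsilon> k \<subseteq> {t - \<epsilon>..}"
        using k(2) unfolding eq by (auto simp: algebra_simps)
    qed (use \<delta> in simp)
  next
    case False
    with s have s: "s = -1" by simp
    \<comment> \<open>These cells are closed on the right. Ceiling minus one selects the cell that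
      begins at t when t is an endpoint, rather than the one that ends there.\<close>
    define k where "k = \<lceil>(a - t) / \<epsilon>\<rceil> - 1"
    have "of_int k < (a - t) / \<epsilon>" "(a - t) / \<epsilon> \<le> of_int k + 1"
      by (auto simp: k_def) linarith+
    then have k: "t < a - of_int k * \<epsilon>" "a - (of_int k + 1) * \<epsilon> \<le> t"
      using \<epsilon> by (auto simp: field_simps)
    have eq: "grid_cell a s \<epsilon> k = {a - (of_int k + 1) * \<epsilon><..a - of_int k * \<epsilon>} \<inter> phase_space"
    proof -
      have "x \<in> (\<lambda>t. a + s * t) ` {of_int k * \<epsilon>..<(of_int k + 1) * \<epsilon>}"
        if "x \<in> {a - (of_int k + 1) * \<epsilon><..a - of_int k * \<epsilon>}" for x
        using that s by (intro image_eqI[of _ _ "a - x"]) auto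
      then show ?thesis using s by (auto simp: grid_cell_def)
    qed
    define \<delta> where "\<delta> = min (1 - t) (a - of_int k * \<epsilon> - t)"
    have \<delta>: "\<delta> \<le> 1 - t" "\<delta> \<le> a - of_int k * \<epsilon> - t" "\<delta> > 0"
      using k t by (auto simp: \<delta>_def)
    show thesis
    proof (rule that[of \<delta> k])
      show "{t<..<t + \<delta>} \<subseteq> grid_cell a s \<epsilon> k"
        using phase[OF \<delta>(1)] \<delta>(2) k unfolding eq by auto
      show "grid_cell a s \<epsilon> k \<subseteq> {t - \<epsilon>..}"
        using k(1) unfolding eq by (auto simp: algebra_simps)
    qed (use \<delta> in simp)
  qed
qed

lemma scaling_quotient_infinite:
  assumes "Z \<epsilon> = \<infinity>" "q < 1" "0 < \<epsilon>" "\<epsilon> < 1"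
  shows "scaling_quotient q Z \<epsilon> = \<infinity>"
proof -
  have "ln \<epsilon> < 0" using assms by simp
  moreover have "1 / (q - 1) < 0" using assms by (simp add: divide_neg_pos)
  ultimately show ?thesis
    using assms by (simp add: scaling_quotient_def elog_def divide_ereal_def)
qed

lemma Limsup_Liminf_at_right:
  fixes f :: "real \<Rightarrow> ereal"
  assumes "(f \<longlongrightarrow> L) (at_right 0)"
  shows "Limsup (at_right 0) f = L" "Liminf (at_right 0) f = L"
  using assms by (auto intro!: lim_imp_Limsup lim_imp_Liminf)

lemma scaling_quotient_infinite_limit:
  assumes "\<epsilon>\<^sub>0 > 0" "\<And>\<epsilon>. 0 < \<epsilon> \<Longrightarrow> \<epsilon> < \<epsilon>\<^sub>0 \<Longrightarrow> Z \<epsilon> = \<infinity>" "q < 1"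
  shows "(scaling_quotient q Z \<longlongrightarrow> \<infinity>) (at_right 0)"
proof (rule tendsto_eventually)
  have "\<forall>\<^sub>F \<epsilon> in at_right 0. \<epsilon> \<in> {0<..<min \<epsilon>\<^sub>0 1}"
    using assms(1) by (intro eventually_at_right_real) auto
  then show "\<forall>\<^sub>F \<epsilon> in at_right 0. scaling_quotient q Z \<epsilon> = \<infinity>"
    by eventually_elim (use assms in \<open>auto intro!: scaling_quotient_infinite\<close>)
qed

context gaspard_wang
begin

lemma T_funpow_cell: "x \<in> cell k \<Longrightarrow> i \<le> k \<Longrightarrow> (T ^^ i) x \<in> cell (k - i)"
proof (induction i)
  case (Suc i)
  then have "(T ^^ i) x \<in> cell (Suc (k - Suc i))" by (simp add: Suc_diff_Suc)
  then show ?case by (simp add: T_cell_Suc)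
qed simp

text \<open>After the jump into I_k the orbit descends one cell per step, so for 0 < m < k its m-th
  point is in a cell of index at least 2, below \<open>gw_c p 2\<close>. The set A may reach into
  I_1 because balls around points of I_0 close to \<open>gw_c p 1\<close> stick out of I_0.\<close>

lemma return_time_ge:
  assumes A: "A \<subseteq> {gw_c p 2..}" and x: "x \<in> piece 0 (cell k)"
  shows "of_nat k \<le> return_time T A x"
  unfolding return_time_def
proof (rule INF_greatest)
  fix m assume m: "m \<in> {m. 0 < m \<and> (T ^^ m) x \<in> A}"
  have "\<not> m < k"
  proof
    assume "m < k"
    from m obtain i where i: "m = Suc i" by (auto simp: gr0_conv_Suc)
    have "T x \<in> cell k" using x by (simp add: piece_def T_cell_0)
    then have "(T ^^ i) (T x) \<in> cell (k - i)"
      using \<open>m < k\<close> i by (intro T_funpow_cell) auto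
    then have "(T ^^ m) x < gw_c p (k - i)"
      unfolding i funpow_Suc_right by (simp add: cell_def)
    also have "\<dots> \<le> gw_c p 2"
      using \<open>m < k\<close> i by (intro c_antimono) auto
    finally show False using m A by auto
  qed
  then show "of_nat k \<le> (of_nat m :: ennreal)" by simp
qed

lemma measure_tail: "measure \<mu> (piece 0 (\<Union>i. cell (k + i))) = mass * gw_c p k"
proof -
  have eq: "(\<Union>i. cell (k + i)) = pre {0<..<1} \<inter> {..<gw_c p k}"
    by (simp add: pre_Int_lessThan piece_unit)
  have "measure lborel (\<Union>i. cell (k + i)) = gw_c p k"
    using emeasure_pre_Int_lessThan[of "{0<..<1}" k] c_pos[of k] unfolding eq
    by (simp add: measure_def)
  then show ?thesis
    using cell_subset by (subst measure_piece_0) auto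
qed

text \<open>Markov at level k: a set of mass of order k^p carries values at least k^(1-q), and
  k^(p+1-q) is unbounded since q < p + 1. Comparing with a constant times an indicator keeps all
  measurability on the side of the lower bound. The threshold K allows for functions known only on
  late pieces, as on a grid cell.\<close>

lemma nn_integral_infinite:
  assumes q: "q < p + 1"
    and f: "\<And>k x. k \<ge> K \<Longrightarrow> x \<in> piece 0 (cell k) \<Longrightarrow> ennreal (real k powr (1 - q)) \<le> f x"
  shows "(\<integral>\<^sup>+x. f x \<partial>\<mu>) = \<infinity>"
proof -
  have lower: "ennreal (mass * 2 powr p * real k powr (p + 1 - q)) \<le> (\<integral>\<^sup>+x. f x \<partial>\<mu>)"
    if k: "k \<ge> max 1 K" for k
  proof -
    let ?V = "piece 0 (\<Union>i. cell (k + i))"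
    \<comment> \<open>Since k + 1 <= 2k for k >= 1, and p is negative.\<close>
    have "(2 * real k) powr p \<le> gw_c p k"
      unfolding gw_c_def using k p_less by (intro powr_mono2') auto
    then have "mass * 2 powr p * real k powr (p + 1 - q) \<le> real k powr (1 - q) * (mass * gw_c p k)"
      using k mass_pos by (simp add: powr_add powr_diff powr_mult field_simps)
    then have "ennreal (mass * 2 powr p * real k powr (p + 1 - q)) \<le>
        ennreal (real k powr (1 - q) * (mass * gw_c p k))"
      by (rule ennreal_leI)
    also have "\<dots> = (\<integral>\<^sup>+x. ennreal (real k powr (1 - q)) * indicator ?V x \<partial>\<mu>)"
      by (simp add: nn_integral_cmult emeasure_eq_measure measure_tail ennreal_mult')
    also have "\<dots> \<le> (\<integral>\<^sup>+x. f x \<partial>\<mu>)"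
    proof (rule nn_integral_mono)
      fix x
      show "ennreal (real k powr (1 - q)) * indicator ?V x \<le> f x"
      proof (cases "x \<in> ?V")
        case True
        then obtain i where i: "x \<in> piece 0 (cell (k + i))" by (auto simp: piece_def)
        have "ennreal (real k powr (1 - q)) \<le> ennreal (real (k + i) powr (1 - q))"
          using q p_less by (intro ennreal_leI powr_mono2) auto
        also have "\<dots> \<le> f x" using i k by (intro f) auto
        finally show ?thesis using True by simp
      qed simp
    qed
    finally show ?thesis .
  qed
  have lim: "filterlim (\<lambda>k. mass * 2 powr p * real k powr (p + 1 - q)) at_top sequentially"
  proof (rule filterlim_tendsto_pos_mult_at_top[OF tendsto_const])
    show "0 < mass * 2 powr p" using mass_pos by simp
    show "filterlim (\<lambda>k. real k powr (p + 1 - q)) at_top sequentially"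
      using q by (intro filterlim_compose[OF real_powr_at_top filterlim_real_sequentially]) auto
  qed
  show ?thesis
  proof (rule ccontr)
    assume "(\<integral>\<^sup>+x. f x \<partial>\<mu>) \<noteq> \<infinity>"
    then obtain r where r: "(\<integral>\<^sup>+x. f x \<partial>\<mu>) = ennreal r" "0 \<le> r"
      by (cases "\<integral>\<^sup>+x. f x \<partial>\<mu>") auto
    have "\<forall>\<^sub>F k in sequentially. r < mass * 2 powr p * real k powr (p + 1 - q)"
      using lim by (simp add: filterlim_at_top_dense)
    moreover have "\<forall>\<^sub>F k in sequentially. k \<ge> max 1 K" by (rule eventually_ge_at_top)
    ultimately have "\<forall>\<^sub>F k :: nat in sequentially. False"
    proof eventually_elim
      case (elim k)
      then show ?case using lower[of k] r by (simp add: ennreal_le_iff)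
    qed
    then show False by simp
  qed
qed

lemma c1_bounds: "gw_c p 2 < gw_c p 1" "0 < gw_c p 1" "gw_c p 1 < 1"
  using c_Suc_less[of 1] c_Suc_less[of 0] c_pos[of 1] c_0 by (simp_all add: numeral_2_eq_2)

lemma Gamma_tau_infinite:
  assumes q: "q < p + 1" and \<epsilon>: "0 < \<epsilon>" "\<epsilon> < gw_c p 1 - gw_c p 2"
  shows "Gamma_tau T \<mu> \<epsilon> q = \<infinity>"
  unfolding Gamma_tau_def
proof (rule nn_integral_infinite[OF q, of 0])
  fix k x assume x: "x \<in> piece 0 (cell k)"
  then have "gw_c p 1 < x" by (simp add: piece_def cell_def)
  \<comment> \<open>The radius is below the length of I_1, so a ball centred in I_0 cannot reach
    beyond I_1.\<close>
  then have "X_ball x \<epsilon> \<subseteq> {gw_c p 2..}"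
    using \<epsilon> by (auto simp: X_ball_def dist_real_def)
  then show "ennreal (real k powr (1 - q)) \<le> epowr (return_time T (X_ball x \<epsilon>) x) (1 - q)"
    using q p_less x by (intro epowr_ge_of_nat return_time_ge) auto
qed

text \<open>Points of I_0 with late returns accumulate at \<open>gw_c p 1\<close> from the right, so
  the one grid cell reaching to the right of that point already contributes an infinite
  integral.\<close>

lemma Upsilon_tau_infinite:
  assumes q: "q < p + 1" and s: "s \<in> {-1, 1}" and \<epsilon>: "0 < \<epsilon>" "\<epsilon> < gw_c p 1 - gw_c p 2"
  shows "Upsilon_tau T \<mu> a s \<epsilon> q = \<infinity>"
proof -
  obtain k \<delta> where \<delta>: "\<delta> > 0" "{gw_c p 1<..<gw_c p 1 + \<delta>} \<subseteq> grid_cell a s \<epsilon> k"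
    and low: "grid_cell a s \<epsilon> k \<subseteq> {gw_c p 1 - \<epsilon>..}"
    using grid_cell_at[OF s \<epsilon>(1), of "gw_c p 1" a] c1_bounds by (metis less_imp_le)
  let ?A = "grid_cell a s \<epsilon> k"
  obtain K where K: "\<And>j. j \<ge> K \<Longrightarrow> gw_c p j < \<delta>"
    using order_tendstoD(2)[OF c_tendsto_0 \<delta>(1)] by (auto simp: eventually_sequentially)
  have "(\<integral>\<^sup>+x. epowr (return_time T ?A x) (1 - q) * indicator ?A x \<partial>\<mu>) = \<infinity>"
  proof (rule nn_integral_infinite[OF q, of K])
    fix j x assume j: "j \<ge> K" and x: "x \<in> piece 0 (cell j)"
    then have br: "branch 0 x < gw_c p j" and x0: "x \<in> cell 0" by (auto simp: piece_def cell_def)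
    have "x = gw_c p 1 + len 0 * branch 0 x"
      using len_pos[of 0] by (simp add: branch_def)
    also have "len 0 * branch 0 x \<le> 1 * branch 0 x"
      using x0 branch_in_unit_iff[of 0 x] c1_bounds c_0
      by (intro mult_right_mono) (auto simp: len_def)
    finally have "x < gw_c p 1 + \<delta>" using K[OF j] br by simp
    moreover have "gw_c p 1 < x" using x0 by (simp add: cell_def)
    ultimately have "x \<in> ?A" using \<delta>(2) by auto
    moreover have "?A \<subseteq> {gw_c p 2..}" using low \<epsilon> by force
    ultimately show "ennreal (real j powr (1 - q)) \<le> epowr (return_time T ?A x) (1 - q) * indicator ?A x"
      using q p_less x by (simp add: epowr_ge_of_nat return_time_ge)
  qed
  moreover have "(\<integral>\<^sup>+x. epowr (return_time T ?A x) (1 - q) * indicator ?A x \<partial>\<mu>) \<le> Upsilon_tau T \<mu> a s \<epsilon> q"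
    unfolding Upsilon_tau_def
    by (rule order_trans[OF _ infsum_mono_neutral[of _ "{k}"]]) (auto simp: nonneg_summable_on_complete)
  ultimately show ?thesis by (simp add: top_unique)
qed

lemma tau_dimensions:
  assumes q: "q < p + 1"
  shows "D_tau_plus T \<mu> q = \<infinity>" "D_tau_minus T \<mu> q = \<infinity>"
    "s \<in> {-1, 1} \<Longrightarrow> Delta_tau_plus T \<mu> a s q = \<infinity>" "s \<in> {-1, 1} \<Longrightarrow> Delta_tau_minus T \<mu> a s q = \<infinity>"
proof -
  have pos: "gw_c p 1 - gw_c p 2 > 0" using c1_bounds by simp
  have q1: "q < 1" using q p_less by simp
  show "D_tau_plus T \<mu> q = \<infinity>" "D_tau_minus T \<mu> q = \<infinity>"
    unfolding D_tau_plus_def D_tau_minus_def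
    using Limsup_Liminf_at_right[OF scaling_quotient_infinite_limit[OF pos Gamma_tau_infinite[OF q] q1]]
    by auto
  show "Delta_tau_plus T \<mu> a s q = \<infinity>" "Delta_tau_minus T \<mu> a s q = \<infinity>" if "s \<in> {-1, 1}"
    unfolding Delta_tau_plus_def Delta_tau_minus_def
    using Limsup_Liminf_at_right[OF scaling_quotient_infinite_limit[OF pos Upsilon_tau_infinite[OF q that] q1]]
    by auto
qed

end

subsection \<open>Measures of balls\<close>

text \<open>Minimum and maximum take care of both signs of the exponent, so q < 1 and q > 1 are
  later treated together.\<close>

lemma powr_between:
  fixes a :: real
  assumes "0 < l" "l \<le> m" "m \<le> u"
  shows "min (l powr a) (u powr a) \<le> m powr a" "m powr a \<le> max (l powr a) (u powr a)"
proof -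
  have "l powr a \<le> m powr a \<and> m powr a \<le> u powr a \<or> u powr a \<le> m powr a \<and> m powr a \<le> l powr a"
  proof (cases "a \<ge> 0")
    case True
    then show ?thesis using assms by (intro disjI1) (auto intro!: powr_mono2)
  next
    case False
    then show ?thesis using assms by (intro disjI2) (auto intro!: powr_mono2')
  qed
  then show "min (l powr a) (u powr a) \<le> m powr a" "m powr a \<le> max (l powr a) (u powr a)"
    by auto
qed

lemma epowr_ennreal: "0 < y \<Longrightarrow> epowr (ennreal y) a = ennreal (y powr a)"
  by (auto simp: epowr_def)

text \<open>Constants and the factor D - ln \<epsilon> disappear, as their logarithms are of smaller
  order than ln \<epsilon>. Dividing by ln \<epsilon> < 0 swaps the bounds.\<close>

lemma log_power_law_limit:
  fixes A B D e :: real
  assumes "A > 0" "B > 0" "D > 0"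
    and bounds: "\<forall>\<^sub>F \<epsilon> in at_right 0. A * \<epsilon> powr e \<le> z \<epsilon> \<and> z \<epsilon> \<le> B * (D - ln \<epsilon>) * \<epsilon> powr e"
  shows "((\<lambda>\<epsilon>. ln (z \<epsilon>) / ln \<epsilon>) \<longlongrightarrow> e) (at_right 0)"
proof (rule tendsto_sandwich)
  have ev: "\<forall>\<^sub>F \<epsilon> in at_right (0::real). \<epsilon> \<in> {0<..<1}"
    by (intro eventually_at_right_real) auto
  show "\<forall>\<^sub>F \<epsilon> in at_right 0. (ln B + ln (D - ln \<epsilon>)) / ln \<epsilon> + e \<le> ln (z \<epsilon>) / ln \<epsilon>"
    using bounds ev
  proof eventually_elim
    case (elim \<epsilon>)
    then have "ln \<epsilon> < 0" by simp
    have "D - ln \<epsilon> > 0" using assms(3) \<open>ln \<epsilon> < 0\<close> by simp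
    have "0 < A * \<epsilon> powr e" using assms(1) elim by simp
    then have "0 < z \<epsilon>" using elim by linarith
    have "ln (z \<epsilon>) \<le> ln (B * (D - ln \<epsilon>) * \<epsilon> powr e)"
      using elim \<open>0 < z \<epsilon>\<close> by (intro ln_mono) auto
    also have "\<dots> = ln B + ln (D - ln \<epsilon>) + e * ln \<epsilon>"
      using assms elim \<open>D - ln \<epsilon> > 0\<close> by (simp add: ln_mult ln_powr)
    finally have "(ln B + ln (D - ln \<epsilon>) + e * ln \<epsilon>) / ln \<epsilon> \<le> ln (z \<epsilon>) / ln \<epsilon>"
      using \<open>ln \<epsilon> < 0\<close> by (intro divide_right_mono_neg) auto
    then show ?case using \<open>ln \<epsilon> < 0\<close> by (simp add: add_divide_distrib)
  qed
  show "\<forall>\<^sub>F \<epsilon> in at_right 0. ln (z \<epsilon>) / ln \<epsilon> \<le> ln A / ln \<epsilon> + e"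
    using bounds ev
  proof eventually_elim
    case (elim \<epsilon>)
    then have "ln \<epsilon> < 0" by simp
    have "ln A + e * ln \<epsilon> = ln (A * \<epsilon> powr e)"
      using assms elim by (simp add: ln_mult ln_powr)
    also have "\<dots> \<le> ln (z \<epsilon>)"
      using elim assms(1) by (intro ln_mono) auto
    finally have "ln (z \<epsilon>) / ln \<epsilon> \<le> (ln A + e * ln \<epsilon>) / ln \<epsilon>"
      using \<open>ln \<epsilon> < 0\<close> by (intro divide_right_mono_neg) auto
    then show ?case using \<open>ln \<epsilon> < 0\<close> by (simp add: add_divide_distrib)
  qed
  show "((\<lambda>\<epsilon>. (ln B + ln (D - ln \<epsilon>)) / ln \<epsilon> + e) \<longlongrightarrow> e) (at_right 0)"
    by real_asymp
  show "((\<lambda>\<epsilon>. ln A / ln \<epsilon> + e) \<longlongrightarrow> e) (at_right 0)"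
    by real_asymp
qed

text \<open>The bounds make the partition function finite and positive for small \<epsilon>, so
  \<open>elog\<close> is the ordinary logarithm there.\<close>

lemma scaling_quotient_power_law:
  assumes pos: "A > 0" "B > 0" "D > 0"
    and bounds: "\<forall>\<^sub>F \<epsilon> in at_right 0. ennreal (A * \<epsilon> powr e) \<le> Z \<epsilon> \<and> Z \<epsilon> \<le> ennreal (B * (D - ln \<epsilon>) * \<epsilon> powr e)"
  shows "(scaling_quotient q Z \<longlongrightarrow> ereal (e / (q - 1))) (at_right 0)"
proof -
  have ev: "\<forall>\<^sub>F \<epsilon> in at_right (0::real). \<epsilon> \<in> {0<..<1}"
    by (intro eventually_at_right_real) auto
  define z where "z \<epsilon> = enn2real (Z \<epsilon>)" for \<epsilon>
  have both: "\<forall>\<^sub>F \<epsilon> in at_right 0. A * \<epsilon> powr e \<le> z \<epsilon> \<and> z \<epsilon> \<le> B * (D - ln \<epsilon>) * \<epsilon> powr e \<and>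
      scaling_quotient q Z \<epsilon> = ereal (1 / (q - 1) * (ln (z \<epsilon>) / ln \<epsilon>))"
    using bounds ev
  proof eventually_elim
    case (elim \<epsilon>)
    have "Z \<epsilon> < \<top>" using elim by (auto intro: le_less_trans)
    then have Z: "Z \<epsilon> = ennreal (z \<epsilon>)" by (simp add: z_def)
    have z0: "0 \<le> z \<epsilon>" by (simp add: z_def)
    have "ln \<epsilon> < 0" using elim by simp
    then have "0 \<le> B * (D - ln \<epsilon>) * \<epsilon> powr e" using pos by simp
    then have "A * \<epsilon> powr e \<le> z \<epsilon>" "z \<epsilon> \<le> B * (D - ln \<epsilon>) * \<epsilon> powr e"
      using elim z0 unfolding Z by (auto simp: ennreal_le_iff)
    moreover have "0 < A * \<epsilon> powr e" using pos elim by simp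
    ultimately have "0 < z \<epsilon>" by linarith
    then have "elog (Z \<epsilon>) = ereal (ln (z \<epsilon>))" by (simp add: elog_def Z)
    then have "scaling_quotient q Z \<epsilon> = ereal (1 / (q - 1) * (ln (z \<epsilon>) / ln \<epsilon>))"
      using \<open>ln \<epsilon> < 0\<close> by (simp add: scaling_quotient_def)
    with \<open>A * \<epsilon> powr e \<le> z \<epsilon>\<close> \<open>z \<epsilon> \<le> B * (D - ln \<epsilon>) * \<epsilon> powr e\<close> show ?case by simp
  qed
  have "((\<lambda>\<epsilon>. ln (z \<epsilon>) / ln \<epsilon>) \<longlongrightarrow> e) (at_right 0)"
    by (rule log_power_law_limit[OF pos]) (use both in \<open>auto elim: eventually_mono\<close>)
  then have "((\<lambda>\<epsilon>. ereal (1 / (q - 1) * (ln (z \<epsilon>) / ln \<epsilon>))) \<longlongrightarrow> ereal (1 / (q - 1) * e)) (at_right 0)"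
    by (intro tendsto_intros)
  moreover have "\<forall>\<^sub>F \<epsilon> in at_right 0. ereal (1 / (q - 1) * (ln (z \<epsilon>) / ln \<epsilon>)) = scaling_quotient q Z \<epsilon>"
    using both by eventually_elim simp
  ultimately show ?thesis
    using tendsto_cong by fastforce
qed

context gaspard_wang
begin

section \<open>Power bounds for the density\<close>

definition beta :: real where
  "beta = - 1 / p"

definition dens_lo :: real where
  "dens_lo = mass / (- 2 * p)"

definition dens_hi :: real where
  "dens_hi = mass * 2 powr (1 - p) / (- p)"

lemma beta_bounds: "0 < beta" "beta < 1"
  using p_less by (auto simp: beta_def field_simps)

lemma dens_lo_pos: "dens_lo > 0" and dens_hi_pos: "dens_hi > 0"
  using p_less mass_pos by (auto simp: dens_lo_def dens_hi_def divide_pos_neg field_simps)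

text \<open>With n = k + 1, the mean value theorem gives \<open>len k\<close> as
  \<open>- p * \<xi> powr (p - 1)\<close> for some \<xi> between n and n + 1 <= 2n, while
  \<open>x powr - beta\<close> also lies between n and n + 1. Replacing n + 1 by 2n produces the
  factors 2 and \<open>2 powr (1 - p)\<close> in \<open>dens_lo\<close> and
  \<open>dens_hi\<close>.\<close>

lemma dens_bounds:
  assumes x: "x \<in> cell k"
  shows "ennreal (dens_lo * x powr - beta) \<le> dens x" "dens x \<le> ennreal (dens_hi * x powr - beta)"
proof -
  let ?n = "real k + 1"
  have x_bounds: "(?n + 1) powr p < x" "x < ?n powr p"
    using x by (auto simp: cell_def gw_c_def add.commute)
  have "0 < x" using x cell_subset by fastforce
  have xb: "x powr - beta = x powr (1 / p)" by (simp add: beta_def)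
  have lo: "?n \<le> x powr - beta"
  proof -
    have "(?n powr p) powr (1 / p) \<le> x powr (1 / p)"
      using x_bounds \<open>0 < x\<close> p_less by (intro powr_mono2') auto
    then show ?thesis using p_less by (simp add: powr_powr xb)
  qed
  have hi: "x powr - beta \<le> ?n + 1"
  proof -
    have "x powr (1 / p) \<le> ((?n + 1) powr p) powr (1 / p)"
      using x_bounds \<open>0 < x\<close> p_less by (intro powr_mono2') auto
    then show ?thesis using p_less by (simp add: powr_powr xb)
  qed
  have "\<exists>\<xi>. ?n < \<xi> \<and> \<xi> < ?n + 1 \<and> (?n + 1) powr p - ?n powr p = (?n + 1 - ?n) * (p * \<xi> powr (p - 1))"
    by (rule MVT2) (auto intro!: derivative_eq_intros)
  then obtain \<xi> where \<xi>: "?n < \<xi>" "\<xi> < ?n + 1" "len k = - p * \<xi> powr (p - 1)"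
    by (auto simp: len_def gw_c_def add.commute)
  have len_hi: "len k \<le> - p * ?n powr (p - 1)"
    unfolding \<xi>(3) using \<xi>(1) p_less by (intro mult_left_mono powr_mono2') auto
  have len_lo: "- p * (2 * ?n) powr (p - 1) \<le> len k"
    unfolding \<xi>(3) using \<xi>(1,2) p_less by (intro mult_left_mono powr_mono2') auto
  have d: "dens x = ennreal (mass * gw_c p k / len k)" by (rule dens_cell[OF x])
  have c: "gw_c p k = ?n * ?n powr (p - 1)"
    by (simp add: gw_c_def powr_diff add.commute)
  have "dens_lo * x powr - beta \<le> dens_lo * (2 * ?n)"
    using hi dens_lo_pos by (intro mult_left_mono) auto
  also have "\<dots> = mass * gw_c p k / (- p * ?n powr (p - 1))"
    using p_less by (simp add: dens_lo_def c field_simps)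
  also have "\<dots> \<le> mass * gw_c p k / len k"
    using len_hi len_pos[of k] mass_pos c_pos[of k] p_less by (intro divide_left_mono) (auto intro!: mult_neg_pos)
  finally show "ennreal (dens_lo * x powr - beta) \<le> dens x"
    unfolding d by (rule ennreal_leI)
  have pow: "(2 * ?n) powr (p - 1) = ?n powr (p - 1) / 2 powr (1 - p)"
  proof -
    have "(2 * ?n) powr (p - 1) = 2 powr (- (1 - p)) * ?n powr (p - 1)"
      by (subst powr_mult) auto
    then show ?thesis unfolding powr_minus_divide by simp
  qed
  have "mass * gw_c p k / len k \<le> mass * gw_c p k / (- p * (2 * ?n) powr (p - 1))"
  proof (rule divide_left_mono[OF len_lo])
    have "0 < - p * (2 * ?n) powr (p - 1)" using p_less by (intro mult_pos_pos) auto
    then show "0 < len k * (- p * (2 * ?n) powr (p - 1))" using len_pos[of k] by (rule mult_pos_pos[rotated])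
  qed (use mass_pos c_pos[of k] in simp)
  also have "\<dots> = dens_hi * ?n"
    using p_less unfolding pow by (simp add: dens_hi_def c field_simps)
  also have "\<dots> \<le> dens_hi * x powr - beta"
    using lo dens_hi_pos by (intro mult_left_mono) auto
  finally show "dens x \<le> ennreal (dens_hi * x powr - beta)"
    unfolding d by (rule ennreal_leI)
qed

lemma dens_le: "dens x \<le> ennreal (dens_hi * x powr - beta) * indicator {0..1} x"
proof (cases "\<exists>k. x \<in> cell k")
  case True
  then show ?thesis using dens_bounds(2) cell_subset_closed by (force simp: indicator_def)
next
  case False
  then have "dens x = 0" by (simp add: dens_def)
  then show ?thesis by simp
qed

lemma AE_lborel_cell: "AE x in lborel. x \<in> {0..1} \<longrightarrow> (\<exists>k. x \<in> cell k)"
proof -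
  have "insert 0 (range (gw_c p)) \<in> null_sets lborel"
    by (intro countable_imp_null_set_lborel) simp
  then have "AE x in lborel. x \<notin> insert 0 (range (gw_c p))" by (rule AE_not_in)
  then show ?thesis
  proof eventually_elim
    case (elim x)
    show ?case
    proof
      assume "x \<in> {0..1}"
      with elim have "x \<in> {0<..1} - range (gw_c p)" by auto
      then show "\<exists>k. x \<in> cell k" using cell_cover by blast
    qed
  qed
qed

lemma emeasure_mu_dens:
  assumes [measurable]: "B \<in> sets borel" and "B \<subseteq> {0..1}"
  shows "emeasure \<mu> B = (\<integral>\<^sup>+x. dens x * indicator B x \<partial>lborel)"
  using nn_integral_mu[of "indicator B"] assms by (simp add: sets_muI)

lemma measure_mu_le:
  assumes B [measurable]: "B \<in> sets borel" "B \<subseteq> {0..1}" and "M \<ge> 0"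
    and M: "\<And>x. x \<in> B \<Longrightarrow> 0 < x \<Longrightarrow> x powr - beta \<le> M"
  shows "measure \<mu> B \<le> dens_hi * M * measure lborel B"
proof -
  have fin: "emeasure lborel B = ennreal (measure lborel B)"
  proof (rule emeasure_eq_ennreal_measure)
    have "emeasure lborel B \<le> emeasure lborel {0..1::real}" using B by (intro emeasure_mono) auto
    then show "emeasure lborel B \<noteq> \<top>" by (auto simp: top_unique)
  qed
  have "emeasure \<mu> B = (\<integral>\<^sup>+x. dens x * indicator B x \<partial>lborel)" using B by (rule emeasure_mu_dens)
  also have "\<dots> \<le> (\<integral>\<^sup>+x. ennreal (dens_hi * M) * indicator B x \<partial>lborel)"
  proof (rule nn_integral_mono)
    fix x
    show "dens x * indicator B x \<le> ennreal (dens_hi * M) * indicator B x"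
    proof (cases "x \<in> B")
      case True
      with B have "0 \<le> x" by auto
      have "dens x \<le> ennreal (dens_hi * x powr - beta)"
        using dens_le[of x] B True by (auto simp: indicator_def)
      \<comment> \<open>At x = 0 the convention \<open>0 powr a = 0\<close> makes the left side
        0.\<close>
      also have "\<dots> \<le> ennreal (dens_hi * M)"
        using M[OF True] dens_hi_pos \<open>M \<ge> 0\<close> \<open>0 \<le> x\<close>
        by (cases "x = 0") (auto intro!: ennreal_leI mult_left_mono)
      finally show ?thesis using True by simp
    qed simp
  qed
  also have "\<dots> = ennreal (dens_hi * M * measure lborel B)"
    using dens_hi_pos \<open>M \<ge> 0\<close> by (simp add: nn_integral_cmult fin ennreal_mult'')
  finally show ?thesis
    using dens_hi_pos \<open>M \<ge> 0\<close> by (simp add: emeasure_eq_measure)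
qed

lemma measure_mu_ge:
  assumes B [measurable]: "B \<in> sets borel" "B \<subseteq> {0..1}" and "M \<ge> 0"
    and M: "\<And>x. x \<in> B \<Longrightarrow> 0 < x \<Longrightarrow> M \<le> x powr - beta"
  shows "dens_lo * M * measure lborel B \<le> measure \<mu> B"
proof -
  have fin: "emeasure lborel B = ennreal (measure lborel B)"
  proof (rule emeasure_eq_ennreal_measure)
    have "emeasure lborel B \<le> emeasure lborel {0..1::real}" using B by (intro emeasure_mono) auto
    then show "emeasure lborel B \<noteq> \<top>" by (auto simp: top_unique)
  qed
  have "ennreal (dens_lo * M * measure lborel B) = (\<integral>\<^sup>+x. ennreal (dens_lo * M) * indicator B x \<partial>lborel)"
    using dens_lo_pos \<open>M \<ge> 0\<close> by (simp add: nn_integral_cmult fin ennreal_mult'')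
  also have "\<dots> \<le> (\<integral>\<^sup>+x. dens x * indicator B x \<partial>lborel)"
  proof (rule nn_integral_mono_AE)
    show "AE x in lborel. ennreal (dens_lo * M) * indicator B x \<le> dens x * indicator B x"
      using AE_lborel_cell
    proof eventually_elim
      case (elim x)
      show ?case
      proof (cases "x \<in> B")
        case True
        then obtain k where k: "x \<in> cell k" using elim B by auto
        then have "0 < x" using cell_subset by fastforce
        then have "ennreal (dens_lo * M) \<le> ennreal (dens_lo * x powr - beta)"
          using M[OF True] dens_lo_pos by (intro ennreal_leI mult_left_mono) auto
        also have "\<dots> \<le> dens x" by (rule dens_bounds(1)[OF k])
        finally show ?thesis using True by simp
      qed simp
    qed
  qed
  also have "\<dots> = emeasure \<mu> B" using B by (rule emeasure_mu_dens[symmetric])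
  finally show ?thesis by (simp add: emeasure_eq_measure)
qed

lemma nn_integral_powr_beta:
  assumes "0 \<le> t"
  shows "(\<integral>\<^sup>+x. ennreal (x powr - beta) * indicator {0..t} x \<partial>lborel) = ennreal (t powr (1 - beta) / (1 - beta))"
  using has_integral_powr_from_0[of "- beta" t] assms beta_bounds
  by (intro nn_integral_has_integral_lebesgue') (auto simp: add.commute)

text \<open>Near 0 the density has no useful supremum, so the estimate uses integrability of
  \<open>x powr - beta\<close>, that is \<open>beta < 1\<close>.\<close>

lemma measure_mu_at_0:
  assumes "0 \<le> t" "t \<le> 1"
  shows "measure \<mu> {0..t} \<le> dens_hi * t powr (1 - beta) / (1 - beta)"
proof -
  have "emeasure \<mu> {0..t} = (\<integral>\<^sup>+x. dens x * indicator {0..t} x \<partial>lborel)"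
    using assms by (intro emeasure_mu_dens) auto
  also have "\<dots> \<le> (\<integral>\<^sup>+x. ennreal dens_hi * (ennreal (x powr - beta) * indicator {0..t} x) \<partial>lborel)"
  proof (rule nn_integral_mono)
    show "dens x * indicator {0..t} x \<le> ennreal dens_hi * (ennreal (x powr - beta) * indicator {0..t} x)" for x
      using dens_le[of x] assms dens_hi_pos
      by (cases "x \<in> {0..t}") (auto simp: ennreal_mult[symmetric])
  qed
  also have "\<dots> = ennreal (dens_hi * t powr (1 - beta) / (1 - beta))"
    using assms dens_hi_pos beta_bounds
    by (simp add: nn_integral_cmult nn_integral_powr_beta ennreal_mult[symmetric])
  finally show ?thesis
    using assms dens_hi_pos beta_bounds by (simp add: emeasure_eq_measure)
qed

section \<open>Two-sided estimates for balls\<close>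

definition ball_scale :: "real \<Rightarrow> real \<Rightarrow> real" where
  "ball_scale \<epsilon> x = \<epsilon> * max x \<epsilon> powr - beta"

lemma ball_scale_pos: "0 < \<epsilon> \<Longrightarrow> 0 < ball_scale \<epsilon> x"
  by (simp add: ball_scale_def less_max_iff_disj)

definition ball_lo :: real where
  "ball_lo = dens_lo / 2"

text \<open>The 6 bounds \<open>3 powr (1 - beta) * 2 powr beta\<close>, which arises for balls
  close to 0; 1 / (1 - beta) comes from integrating the density from 0.\<close>

definition ball_hi :: real where
  "ball_hi = 6 * dens_hi / (1 - beta)"

lemma ball_lo_pos: "ball_lo > 0" and ball_hi_pos: "ball_hi > 0"
  using dens_lo_pos dens_hi_pos beta_bounds by (auto simp: ball_lo_def ball_hi_def)

lemma X_ball_eq: "X_ball x \<epsilon> = {x - \<epsilon><..<x + \<epsilon>} \<inter> {0..1}"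
  by (auto simp: X_ball_def phase_space_def dist_real_def)

lemma X_ball_borel [measurable, simp]: "X_ball x \<epsilon> \<in> sets borel"
  by (simp add: X_ball_eq)

lemma X_ball_sets: "X_ball x \<epsilon> \<in> sets \<mu>"
  by (intro sets_muI) (auto simp: X_ball_eq)

lemma two_powr_beta_le: "2 powr beta \<le> 2" "3 powr (1 - beta) \<le> 3"
  using beta_bounds powr_mono[of beta 1 2] powr_mono[of "1 - beta" 1 3] by auto

text \<open>Half of the ball suffices. If \<epsilon> <= x, the left half has density at least of the
  order at x; otherwise the right half lies in (0, 2\<epsilon>), inside [0, 1] as \<epsilon> <= 1/2,
  and the loss \<open>2 powr beta\<close> is absorbed by the 2 in \<open>ball_lo\<close>.\<close>

lemma measure_ball_ge:
  assumes \<epsilon>: "0 < \<epsilon>" "\<epsilon> \<le> 1/2" and x: "0 < x" "x \<le> 1"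
  shows "ball_lo * ball_scale \<epsilon> x \<le> measure \<mu> (X_ball x \<epsilon>)"
proof (cases "\<epsilon> \<le> x")
  case True
  have "ball_lo * ball_scale \<epsilon> x \<le> dens_lo * ball_scale \<epsilon> x"
    using dens_lo_pos ball_scale_pos[OF \<epsilon>(1), of x] by (intro mult_right_mono) (auto simp: ball_lo_def)
  also have "\<dots> = dens_lo * x powr - beta * measure lborel {x - \<epsilon><..<x}"
    using True \<epsilon> by (simp add: ball_scale_def)
  also have "\<dots> \<le> measure \<mu> {x - \<epsilon><..<x}"
    using True x beta_bounds by (intro measure_mu_ge powr_mono2') auto
  also have "\<dots> \<le> measure \<mu> (X_ball x \<epsilon>)"
    using True x \<epsilon> by (intro finite_measure_mono X_ball_sets) (auto simp: X_ball_eq)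
  finally show ?thesis .
next
  case False
  have "ball_scale \<epsilon> x = \<epsilon> * \<epsilon> powr - beta" using False by (simp add: ball_scale_def max_def)
  also have "\<dots> \<le> \<epsilon> * (2 * (2 * \<epsilon>) powr - beta)"
  proof -
    have "\<epsilon> powr - beta = 2 powr beta * (2 * \<epsilon>) powr - beta"
      using \<epsilon> by (simp add: powr_mult powr_minus)
    then show ?thesis using two_powr_beta_le(1) \<epsilon> by (intro mult_left_mono) (auto intro!: mult_right_mono)
  qed
  finally have "ball_lo * ball_scale \<epsilon> x \<le> ball_lo * (\<epsilon> * (2 * (2 * \<epsilon>) powr - beta))"
    using ball_lo_pos by (intro mult_left_mono) auto
  also have "\<dots> = dens_lo * (2 * \<epsilon>) powr - beta * measure lborel {x<..<x + \<epsilon>}"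
    using \<epsilon> by (simp add: ball_lo_def)
  also have "\<dots> \<le> measure \<mu> {x<..<x + \<epsilon>}"
    using False \<epsilon> x beta_bounds by (intro measure_mu_ge powr_mono2') auto
  also have "\<dots> \<le> measure \<mu> (X_ball x \<epsilon>)"
    using False x \<epsilon> by (intro finite_measure_mono X_ball_sets) (auto simp: X_ball_eq)
  finally show ?thesis .
qed

text \<open>For x >= 2\<epsilon> the ball stays to the right of x / 2, where the density is bounded;
  otherwise it lies in [0, 3\<epsilon>].\<close>

lemma measure_ball_le:
  assumes \<epsilon>: "0 < \<epsilon>" "\<epsilon> \<le> 1/3" and x: "0 < x" "x \<le> 1"
  shows "measure \<mu> (X_ball x \<epsilon>) \<le> ball_hi * ball_scale \<epsilon> x"
proof (cases "2 * \<epsilon> \<le> x")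
  case True
  have "measure \<mu> (X_ball x \<epsilon>) \<le> dens_hi * (x / 2) powr - beta * measure lborel (X_ball x \<epsilon>)"
    using True x \<epsilon> beta_bounds by (intro measure_mu_le powr_mono2') (auto simp: X_ball_eq)
  also have "\<dots> \<le> dens_hi * (x / 2) powr - beta * (2 * \<epsilon>)"
  proof (rule mult_left_mono)
    have "measure lborel (X_ball x \<epsilon>) \<le> measure lborel {x - \<epsilon><..<x + \<epsilon>}"
      using \<epsilon> by (intro measure_mono_fmeasurable) (auto simp: X_ball_eq fmeasurable_def)
    then show "measure lborel (X_ball x \<epsilon>) \<le> 2 * \<epsilon>" using \<epsilon> by simp
  qed (use dens_hi_pos in auto)
  also have "\<dots> = 2 * 2 powr beta * (dens_hi * (\<epsilon> * x powr - beta))"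
    using x by (simp add: powr_divide powr_minus field_simps)
  also have "\<dots> \<le> 6 / (1 - beta) * (dens_hi * (\<epsilon> * x powr - beta))"
  proof (rule mult_right_mono)
    have "2 * 2 powr beta \<le> 6 / 1" using two_powr_beta_le by simp
    also have "\<dots> \<le> 6 / (1 - beta)" using beta_bounds by (intro divide_left_mono) auto
    finally show "2 * 2 powr beta \<le> 6 / (1 - beta)" .
  qed (use dens_hi_pos \<epsilon> in auto)
  also have "\<dots> = ball_hi * ball_scale \<epsilon> x"
    using True \<epsilon> by (simp add: ball_hi_def ball_scale_def max_def)
  finally show ?thesis .
next
  case False
  have "measure \<mu> (X_ball x \<epsilon>) \<le> measure \<mu> {0..3 * \<epsilon>}"
    using False \<epsilon> by (intro finite_measure_mono sets_muI) (auto simp: X_ball_eq)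
  also have "\<dots> \<le> dens_hi * (3 * \<epsilon>) powr (1 - beta) / (1 - beta)"
    using \<epsilon> by (intro measure_mu_at_0) auto
  also have "\<dots> = (3 powr (1 - beta) * 2 powr beta) * (dens_hi / (1 - beta) * (\<epsilon> * (2 * \<epsilon>) powr - beta))"
  proof -
    have "\<epsilon> powr (1 - beta) = \<epsilon> * \<epsilon> powr - beta"
      using \<epsilon> powr_add[of \<epsilon> 1 "- beta"] by simp
    then have "(3 * \<epsilon>) powr (1 - beta) = 3 powr (1 - beta) * (\<epsilon> * \<epsilon> powr - beta)"
      using \<epsilon> by (simp add: powr_mult)
    moreover have "\<epsilon> powr - beta = 2 powr beta * (2 * \<epsilon>) powr - beta"
      using \<epsilon> by (simp add: powr_mult powr_minus)
    ultimately show ?thesis by simp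
  qed
  also have "\<dots> \<le> (3 * 2) * (dens_hi / (1 - beta) * ball_scale \<epsilon> x)"
  proof (rule mult_mono)
    show "3 powr (1 - beta) * 2 powr beta \<le> 3 * 2"
      using two_powr_beta_le by (intro mult_mono) auto
    have "(2 * \<epsilon>) powr - beta \<le> max x \<epsilon> powr - beta"
      using False \<epsilon> beta_bounds by (intro powr_mono2') auto
    then show "dens_hi / (1 - beta) * (\<epsilon> * (2 * \<epsilon>) powr - beta) \<le> dens_hi / (1 - beta) * ball_scale \<epsilon> x"
      unfolding ball_scale_def using \<epsilon> dens_hi_pos beta_bounds by (intro mult_left_mono) auto
  qed (use dens_hi_pos beta_bounds \<epsilon> in auto)
  also have "\<dots> = ball_hi * ball_scale \<epsilon> x" by (simp add: ball_hi_def)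
  finally show ?thesis .
qed

end

subsection \<open>Partition functions of the measure\<close>

context gaspard_wang
begin

text \<open>For small \<epsilon> the smaller exponent dominates. The two agree exactly when beta * q
  = 1, that is at q = - p, where the formulas for the dimensions switch.\<close>

definition mu_exponent :: "real \<Rightarrow> real" where
  "mu_exponent q = min (q - 1) ((1 - beta) * q)"

definition const_lo :: "real \<Rightarrow> real" where
  "const_lo q = min (ball_lo powr (q - 1)) (ball_hi powr (q - 1))"

definition const_hi :: "real \<Rightarrow> real" where
  "const_hi q = max (ball_lo powr (q - 1)) (ball_hi powr (q - 1))"

lemma const_pos: "const_lo q > 0" "const_hi q > 0"
  using ball_lo_pos ball_hi_pos by (auto simp: const_lo_def const_hi_def less_max_iff_disj)

lemma measure_ball_pos:
  assumes "0 < \<epsilon>" "\<epsilon> \<le> 1/3" "0 < x" "x \<le> 1"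
  shows "0 < measure \<mu> (X_ball x \<epsilon>)"
proof -
  have "0 < ball_lo * ball_scale \<epsilon> x"
    using assms ball_lo_pos ball_scale_pos by simp
  also have "\<dots> \<le> measure \<mu> (X_ball x \<epsilon>)"
    using assms by (intro measure_ball_ge) auto
  finally show ?thesis .
qed

lemma epowr_ball:
  assumes "0 < \<epsilon>" "\<epsilon> \<le> 1/3" "0 < x" "x \<le> 1"
  shows "ennreal (const_lo q * ball_scale \<epsilon> x powr (q - 1)) \<le> epowr (emeasure \<mu> (X_ball x \<epsilon>)) (q - 1)"
    "epowr (emeasure \<mu> (X_ball x \<epsilon>)) (q - 1) \<le> ennreal (const_hi q * ball_scale \<epsilon> x powr (q - 1))"
proof -
  let ?m = "measure \<mu> (X_ball x \<epsilon>)" and ?w = "ball_scale \<epsilon> x"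
  have w: "?w > 0" using assms by (intro ball_scale_pos)
  have m: "?m > 0" using assms by (rule measure_ball_pos)
  have b: "ball_lo \<le> ?m / ?w" "?m / ?w \<le> ball_hi"
    using measure_ball_ge[of \<epsilon> x] measure_ball_le[of \<epsilon> x] assms w by (auto simp: field_simps)
  have "?m powr (q - 1) = (?m / ?w) powr (q - 1) * ?w powr (q - 1)"
    using m w by (simp add: powr_divide)
  then have "const_lo q * ?w powr (q - 1) \<le> ?m powr (q - 1)" "?m powr (q - 1) \<le> const_hi q * ?w powr (q - 1)"
    using powr_between[OF ball_lo_pos b, of "q - 1"] by (auto simp: const_lo_def const_hi_def intro!: mult_right_mono)
  then show "ennreal (const_lo q * ?w powr (q - 1)) \<le> epowr (emeasure \<mu> (X_ball x \<epsilon>)) (q - 1)"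
    "epowr (emeasure \<mu> (X_ball x \<epsilon>)) (q - 1) \<le> ennreal (const_hi q * ?w powr (q - 1))"
    using m by (auto simp: emeasure_eq_measure epowr_ennreal intro!: ennreal_leI)
qed

lemma AE_mu_pos: "AE x in \<mu>. 0 < x \<and> x \<le> 1"
  using AE_cell
proof eventually_elim
  case (elim x)
  then show ?case using cell_subset by fastforce
qed

text \<open>Reduces a lower bound for the partition function to the choice of a test set B.\<close>

lemma Gamma_mu_ge_measure:
  assumes \<epsilon>: "0 < \<epsilon>" "\<epsilon> \<le> 1/3" and B: "B \<in> sets \<mu>" and "0 \<le> C"
    and C: "\<And>x. x \<in> B \<Longrightarrow> 0 < x \<Longrightarrow> x \<le> 1 \<Longrightarrow> C \<le> const_lo q * ball_scale \<epsilon> x powr (q - 1)"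
  shows "ennreal (C * measure \<mu> B) \<le> Gamma_mu \<mu> \<epsilon> q"
proof -
  have "ennreal (C * measure \<mu> B) = (\<integral>\<^sup>+x. ennreal C * indicator B x \<partial>\<mu>)"
    using B \<open>0 \<le> C\<close> by (simp add: nn_integral_cmult emeasure_eq_measure ennreal_mult)
  also have "\<dots> \<le> (\<integral>\<^sup>+x. epowr (emeasure \<mu> (X_ball x \<epsilon>)) (q - 1) \<partial>\<mu>)"
  proof (rule nn_integral_mono_AE)
    show "AE x in \<mu>. ennreal C * indicator B x \<le> epowr (emeasure \<mu> (X_ball x \<epsilon>)) (q - 1)"
      using AE_mu_pos
    proof eventually_elim
      case (elim x)
      show ?case
      proof (cases "x \<in> B")
        case True
        have "ennreal C \<le> ennreal (const_lo q * ball_scale \<epsilon> x powr (q - 1))"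
          using C[OF True] elim by (intro ennreal_leI) auto
        also have "\<dots> \<le> epowr (emeasure \<mu> (X_ball x \<epsilon>)) (q - 1)"
          using \<epsilon> elim by (intro epowr_ball) auto
        finally show ?thesis using True by simp
      qed simp
    qed
  qed
  finally show ?thesis by (simp add: Gamma_mu_def)
qed

lemma scale_powr_small:
  assumes "0 < \<epsilon>" "x \<le> \<epsilon>"
  shows "ball_scale \<epsilon> x powr (q - 1) = \<epsilon> powr ((1 - beta) * (q - 1))"
proof -
  have "ball_scale \<epsilon> x = \<epsilon> powr 1 * \<epsilon> powr - beta" using assms by (simp add: ball_scale_def max_def)
  also have "\<dots> = \<epsilon> powr (1 - beta)" by (simp only: powr_add[symmetric]) simp
  finally show ?thesis by (simp add: powr_powr)
qed

lemma scale_powr_large: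
  assumes "0 < \<epsilon>" "\<epsilon> \<le> x"
  shows "ball_scale \<epsilon> x powr (q - 1) = \<epsilon> powr (q - 1) * x powr (- beta * (q - 1))"
  using assms by (simp add: ball_scale_def max_def powr_mult powr_powr)

text \<open>The 1/2 is the length of the test set (1/2, 1), and the power bounds
  \<open>x powr (- beta * (q - 1))\<close> there; the 1 in the minimum lets the same constant serve
  the test set near 0.\<close>

definition Gamma_lo :: "real \<Rightarrow> real" where
  "Gamma_lo q = const_lo q * dens_lo * min 1 ((1/2) powr (- beta * (q - 1))) / 2"

lemma Gamma_lo_pos: "Gamma_lo q > 0"
  using const_pos[of q] dens_lo_pos by (simp add: Gamma_lo_def)

text \<open>The test set is taken where the dominant exponent arises: (1/2, 1) for q - 1, and (0,
  \<epsilon>) for (1 - beta) * q.\<close>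

lemma Gamma_mu_ge:
  assumes \<epsilon>: "0 < \<epsilon>" "\<epsilon> \<le> 1/3"
  shows "ennreal (Gamma_lo q * \<epsilon> powr mu_exponent q) \<le> Gamma_mu \<mu> \<epsilon> q"
proof -
  let ?\<kappa> = "min 1 ((1/2) powr (- beta * (q - 1)))"
  have \<kappa>: "0 < ?\<kappa>" "?\<kappa> \<le> 1" by auto
  show ?thesis
  proof (cases "q - 1 \<le> (1 - beta) * q")
    case True
    let ?B = "{1/2<..<1::real}" and ?C = "const_lo q * (\<epsilon> powr (q - 1) * ?\<kappa>)"
    have sub: "?B \<subseteq> {0..1}" by auto
    have "1 * 1 * measure lborel ?B * dens_lo \<le> measure \<mu> ?B"
      using measure_mu_ge[of ?B 1, OF _ sub] beta_bounds powr_mono2'[of "- beta" _ 1] by (auto simp: mult_ac)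
    then have "?C * (dens_lo / 2) \<le> ?C * measure \<mu> ?B"
      using const_pos[of q] \<kappa> by (intro mult_left_mono) (auto simp: less_imp_le)
    then have "ennreal (?C * (dens_lo / 2)) \<le> ennreal (?C * measure \<mu> ?B)" by (rule ennreal_leI)
    also have "\<dots> \<le> Gamma_mu \<mu> \<epsilon> q"
    proof (rule Gamma_mu_ge_measure[OF \<epsilon>])
      fix x :: real assume x: "x \<in> ?B"
      have "?\<kappa> \<le> x powr (- beta * (q - 1))"
        using powr_between(1)[of "1/2" x 1 "- beta * (q - 1)"] x by (simp add: min.commute)
      then have "?C \<le> const_lo q * (\<epsilon> powr (q - 1) * x powr (- beta * (q - 1)))"
        using const_pos[of q] by (intro mult_left_mono) auto
      then show "?C \<le> const_lo q * ball_scale \<epsilon> x powr (q - 1)"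
        using x \<epsilon> by (subst scale_powr_large) auto
    qed (use const_pos[of q] \<kappa> in \<open>auto intro!: sets_muI simp: less_imp_le\<close>)
    also have "?C * (dens_lo / 2) = Gamma_lo q * \<epsilon> powr mu_exponent q"
      using True by (simp add: Gamma_lo_def mu_exponent_def)
    finally show ?thesis .
  next
    case False
    let ?B = "{0<..<\<epsilon>}" and ?C = "const_lo q * \<epsilon> powr ((1 - beta) * (q - 1))"
    have "dens_lo * \<epsilon> powr - beta * measure lborel ?B \<le> measure \<mu> ?B"
      using \<epsilon> beta_bounds by (intro measure_mu_ge powr_mono2') auto
    then have *: "?C * (dens_lo * \<epsilon> powr - beta * \<epsilon>) \<le> ?C * measure \<mu> ?B"
      using const_pos[of q] \<epsilon> by (intro mult_left_mono) (auto simp: less_imp_le)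
    have "\<epsilon> powr ((1 - beta) * (q - 1)) * \<epsilon> powr - beta * \<epsilon> powr 1 = \<epsilon> powr ((1 - beta) * q)"
      unfolding powr_add[symmetric] by (simp add: algebra_simps)
    then have eq: "?C * (dens_lo * \<epsilon> powr - beta * \<epsilon>) = const_lo q * dens_lo * \<epsilon> powr ((1 - beta) * q)"
      using \<epsilon> by (simp add: mult_ac)
    have "Gamma_lo q * \<epsilon> powr mu_exponent q = (const_lo q * dens_lo * \<epsilon> powr ((1 - beta) * q)) * (?\<kappa> / 2)"
      using False by (simp add: Gamma_lo_def mu_exponent_def)
    also have "\<dots> \<le> (const_lo q * dens_lo * \<epsilon> powr ((1 - beta) * q)) * 1"
      using \<kappa> const_pos[of q] dens_lo_pos by (intro mult_left_mono) auto
    also have "\<dots> \<le> ?C * measure \<mu> ?B" using * by (simp add: eq)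
    finally have "ennreal (Gamma_lo q * \<epsilon> powr mu_exponent q) \<le> ennreal (?C * measure \<mu> ?B)"
      by (rule ennreal_leI)
    also have "\<dots> \<le> Gamma_mu \<mu> \<epsilon> q"
    proof (rule Gamma_mu_ge_measure[OF \<epsilon>])
      fix x :: real assume x: "x \<in> ?B"
      then show "?C \<le> const_lo q * ball_scale \<epsilon> x powr (q - 1)"
        using \<epsilon> by (subst scale_powr_small) auto
    qed (use const_pos[of q] \<epsilon> in \<open>auto intro!: sets_muI simp: less_imp_le\<close>)
    finally show ?thesis .
  qed
qed

text \<open>The factor \<open>1 / x\<close> trades the exact integral of \<open>x powr (- beta * q)\<close> over
  \<open>[\<epsilon>, 1]\<close> for a logarithm, which avoids distinguishing whether \<open>beta * q\<close> exceeds 1.\<close>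

lemma integrand_le:
  assumes \<epsilon>: "0 < \<epsilon>" "\<epsilon> \<le> 1" and x: "0 < x" "x \<le> 1"
  shows "ball_scale \<epsilon> x powr (q - 1) * x powr - beta \<le>
    \<epsilon> powr ((1 - beta) * (q - 1)) * (x powr - beta * indicator {0..\<epsilon>} x) +
    \<epsilon> powr mu_exponent q * (1 / x * indicator {\<epsilon>..1} x)"
proof (cases "x < \<epsilon>")
  case True
  then show ?thesis using \<epsilon> x by (simp add: scale_powr_small)
next
  case False
  have "x powr (- beta * (q - 1)) * x powr - beta = x powr (1 - beta * q) * x powr - 1"
    unfolding powr_add[symmetric] by (simp add: algebra_simps)
  also have "x powr - 1 = 1 / x" using x by (simp add: powr_minus_divide)
  finally have "ball_scale \<epsilon> x powr (q - 1) * x powr - beta = \<epsilon> powr (q - 1) * x powr (1 - beta * q) * (1 / x)"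
    using False \<epsilon> by (simp add: scale_powr_large mult.assoc)
  also have "\<dots> \<le> \<epsilon> powr mu_exponent q * (1 / x)"
  proof (rule mult_right_mono)
    \<comment> \<open>Multiplied by \<open>\<epsilon> powr (q - 1)\<close>, the two endpoint values
      on [\<epsilon>, 1] become the two candidate powers in \<open>mu_exponent\<close>.\<close>
    have "x powr (1 - beta * q) \<le> max (\<epsilon> powr (1 - beta * q)) 1"
      using powr_between(2)[of \<epsilon> x 1 "1 - beta * q"] False \<epsilon> x by simp
    then have "\<epsilon> powr (q - 1) * x powr (1 - beta * q) \<le> \<epsilon> powr (q - 1) * max (\<epsilon> powr (1 - beta * q)) 1"
      by (intro mult_left_mono) auto
    also have "\<dots> = max (\<epsilon> powr ((1 - beta) * q)) (\<epsilon> powr (q - 1))"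
      by (simp add: max_mult_distrib_left powr_add[symmetric] algebra_simps)
    also have "\<dots> \<le> \<epsilon> powr mu_exponent q"
      using \<epsilon> by (auto simp: mu_exponent_def intro!: powr_mono')
    finally show "\<epsilon> powr (q - 1) * x powr (1 - beta * q) \<le> \<epsilon> powr mu_exponent q" .
  qed (use x in simp)
  finally have "ball_scale \<epsilon> x powr (q - 1) * x powr - beta \<le> \<epsilon> powr mu_exponent q * (1 / x * indicator {\<epsilon>..1} x)"
    using False x by simp
  then show ?thesis by (rule order_trans) simp
qed

lemma nn_integral_inverse:
  assumes "0 < \<epsilon>" "\<epsilon> \<le> 1"
  shows "(\<integral>\<^sup>+x. ennreal (1 / x) * indicator {\<epsilon>..1} x \<partial>lborel) = ennreal (- ln \<epsilon>)"
proof -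
  have "((\<lambda>x. 1 / x) has_integral (ln 1 - ln \<epsilon>)) {\<epsilon>..1}"
    using assms
    by (intro fundamental_theorem_of_calculus)
      (auto intro!: derivative_eq_intros simp flip: has_real_derivative_iff_has_vector_derivative)
  then show ?thesis
    using assms by (subst nn_integral_has_integral_lebesgue') auto
qed

text \<open>The part on [0, \<epsilon>] integrates to a multiple of
  \<open>\<epsilon> powr ((1 - beta) * q)\<close>, which is at most
  \<open>\<epsilon> powr mu_exponent q\<close>; the part on [\<epsilon>, 1] contributes the
  logarithm.\<close>

lemma Gamma_mu_le:
  assumes \<epsilon>: "0 < \<epsilon>" "\<epsilon> \<le> 1/3"
  shows "Gamma_mu \<mu> \<epsilon> q \<le> ennreal (const_hi q * dens_hi * (1 / (1 - beta) - ln \<epsilon>) * \<epsilon> powr mu_exponent q)"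
proof -
  let ?K = "const_hi q * dens_hi"
  let ?S = "\<epsilon> powr ((1 - beta) * (q - 1))" and ?E = "\<epsilon> powr mu_exponent q"
  have K: "?K > 0" using const_pos[of q] dens_hi_pos by simp
  have [measurable]: "ball_scale \<epsilon> \<in> borel_measurable borel"
    unfolding ball_scale_def by measurable
  have "Gamma_mu \<mu> \<epsilon> q \<le> (\<integral>\<^sup>+x. ennreal (const_hi q * ball_scale \<epsilon> x powr (q - 1)) \<partial>\<mu>)"
    unfolding Gamma_mu_def
  proof (rule nn_integral_mono_AE)
    show "AE x in \<mu>. epowr (emeasure \<mu> (X_ball x \<epsilon>)) (q - 1) \<le> ennreal (const_hi q * ball_scale \<epsilon> x powr (q - 1))"
      using AE_mu_pos by eventually_elim (use \<epsilon> in \<open>auto intro: epowr_ball\<close>)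
  qed
  also have "\<dots> = (\<integral>\<^sup>+x. dens x * ennreal (const_hi q * ball_scale \<epsilon> x powr (q - 1)) \<partial>lborel)"
    by (rule nn_integral_mu) measurable
  also have "\<dots> \<le> (\<integral>\<^sup>+x. ennreal (?K * ?S) * (ennreal (x powr - beta) * indicator {0..\<epsilon>} x) +
      ennreal (?K * ?E) * (ennreal (1 / x) * indicator {\<epsilon>..1} x) \<partial>lborel)"
  proof (rule nn_integral_mono)
    fix x :: real
    show "dens x * ennreal (const_hi q * ball_scale \<epsilon> x powr (q - 1)) \<le>
      ennreal (?K * ?S) * (ennreal (x powr - beta) * indicator {0..\<epsilon>} x) +
      ennreal (?K * ?E) * (ennreal (1 / x) * indicator {\<epsilon>..1} x)" (is "?l \<le> ?r")
    proof (cases "0 < x \<and> x \<le> 1")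
      case True
      have "?l \<le> ennreal (dens_hi * x powr - beta) * ennreal (const_hi q * ball_scale \<epsilon> x powr (q - 1))"
        using dens_le[of x] True by (intro mult_right_mono) auto
      also have "\<dots> = ennreal (?K * (ball_scale \<epsilon> x powr (q - 1) * x powr - beta))"
        using dens_hi_pos const_pos[of q] by (simp add: ennreal_mult[symmetric] mult_ac)
      also have "\<dots> \<le> ennreal (?K * (?S * (x powr - beta * indicator {0..\<epsilon>} x) + ?E * (1 / x * indicator {\<epsilon>..1} x)))"
        using integrand_le[of \<epsilon> x q] True \<epsilon> K by (intro ennreal_leI mult_left_mono) auto
      also have "\<dots> = ennreal (?K * ?S * (x powr - beta * indicator {0..\<epsilon>} x)) +
          ennreal (?K * ?E * (1 / x * indicator {\<epsilon>..1} x))"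
        using True const_pos[of q] dens_hi_pos
        by (subst ennreal_plus[symmetric]) (auto simp: distrib_left mult.assoc)
      also have "\<dots> = ?r"
        using True K
        by (cases "x \<in> {0..\<epsilon>}"; cases "x \<in> {\<epsilon>..1}") (auto simp: ennreal_mult[symmetric])
      finally show ?thesis .
    next
      case False
      then have "dens x = 0 \<or> x = 0" using dens_le[of x] by (cases "x = 0") (auto simp: indicator_def)
      moreover have "dens 0 = 0"
        using dens_le[of 0] by simp
      ultimately have "dens x = 0" by auto
      then show ?thesis by simp
    qed
  qed
  also have "\<dots> = ennreal (?K * ?S) * ennreal (\<epsilon> powr (1 - beta) / (1 - beta)) + ennreal (?K * ?E) * ennreal (- ln \<epsilon>)"
    using \<epsilon> by (simp add: nn_integral_add nn_integral_cmult nn_integral_powr_beta nn_integral_inverse)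
  also have "\<dots> = ennreal (?K * (\<epsilon> powr ((1 - beta) * q) / (1 - beta) + ?E * (- ln \<epsilon>)))"
  proof -
    have "?S * \<epsilon> powr (1 - beta) = \<epsilon> powr ((1 - beta) * q)"
      by (simp add: powr_add[symmetric] algebra_simps)
    then have eq: "?K * (\<epsilon> powr ((1 - beta) * q) / (1 - beta) + ?E * (- ln \<epsilon>)) =
        ?K * ?S * (\<epsilon> powr (1 - beta) / (1 - beta)) + ?K * ?E * (- ln \<epsilon>)"
      by (simp add: right_diff_distrib mult.assoc)
    have nonneg: "0 \<le> ?K * ?S" "0 \<le> ?K * ?E" "0 \<le> \<epsilon> powr (1 - beta) / (1 - beta)" "0 \<le> - ln \<epsilon>"
      using K beta_bounds \<epsilon> by auto
    show ?thesis
      unfolding eq using nonneg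
      by (simp only: ennreal_plus[OF mult_nonneg_nonneg mult_nonneg_nonneg] ennreal_mult)
  qed
  also have "\<dots> \<le> ennreal (?K * (?E / (1 - beta) + ?E * (- ln \<epsilon>)))"
  proof -
    have "\<epsilon> powr ((1 - beta) * q) \<le> ?E"
      using \<epsilon> by (auto simp: mu_exponent_def intro!: powr_mono')
    then show ?thesis
      using K beta_bounds by (intro ennreal_leI mult_left_mono add_right_mono divide_right_mono) auto
  qed
  also have "?K * (?E / (1 - beta) + ?E * (- ln \<epsilon>)) = ?K * (1 / (1 - beta) - ln \<epsilon>) * ?E"
    by (simp add: algebra_simps)
  finally show ?thesis .
qed

lemma eventually_small: "\<forall>\<^sub>F \<epsilon> in at_right (0::real). 0 < \<epsilon> \<and> \<epsilon> \<le> 1/3"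
proof -
  have "\<forall>\<^sub>F \<epsilon> in at_right (0::real). \<epsilon> \<in> {0<..<1/3}" by (intro eventually_at_right_real) auto
  then show ?thesis by eventually_elim auto
qed

lemma mu_quotient_limit_neq_1:
  assumes "q \<noteq> 1"
  shows "(mu_quotient \<mu> q \<longlongrightarrow> ereal (mu_exponent q / (q - 1))) (at_right 0)"
proof -
  have "(scaling_quotient q (\<lambda>\<epsilon>. Gamma_mu \<mu> \<epsilon> q) \<longlongrightarrow> ereal (mu_exponent q / (q - 1))) (at_right 0)"
  proof (rule scaling_quotient_power_law)
    show "Gamma_lo q > 0" by (rule Gamma_lo_pos)
    show "const_hi q * dens_hi > 0" using const_pos dens_hi_pos by simp
    show "1 / (1 - beta) > 0" using beta_bounds by simp
    show "\<forall>\<^sub>F \<epsilon> in at_right 0. ennreal (Gamma_lo q * \<epsilon> powr mu_exponent q) \<le> Gamma_mu \<mu> \<epsilon> q \<and>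
        Gamma_mu \<mu> \<epsilon> q \<le> ennreal (const_hi q * dens_hi * (1 / (1 - beta) - ln \<epsilon>) * \<epsilon> powr mu_exponent q)"
      using eventually_small by eventually_elim (intro conjI Gamma_mu_ge Gamma_mu_le; simp)
  qed
  moreover have "mu_quotient \<mu> q = scaling_quotient q (\<lambda>\<epsilon>. Gamma_mu \<mu> \<epsilon> q)"
    using assms by (simp add: mu_quotient_def fun_eq_iff)
  ultimately show ?thesis by simp
qed

section \<open>The case q = 1\<close>

lemma measure_ball_measurable: "(\<lambda>x. measure \<mu> (X_ball x \<epsilon>)) \<in> borel_measurable borel"
proof -
  let ?D = "distr \<mu> borel (\<lambda>x. x)"
  interpret D: prob_space ?D
    by (rule prob_space_distr) (auto intro: borel_measurable_mu)
  \<comment> \<open>Balls are the sections of this open strip around the diagonal, so their measure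
    depends measurably on the centre.\<close>
  let ?Q = "{z :: real \<times> real. dist (fst z) (snd z) < \<epsilon>}"
  have "open ?Q" by (intro open_Collect_less continuous_intros)
  then have "?Q \<in> sets (borel \<Otimes>\<^sub>M borel)"
    unfolding borel_prod by simp
  also have "sets (borel \<Otimes>\<^sub>M borel) = sets (borel \<Otimes>\<^sub>M ?D)"
    by (intro sets_pair_measure_cong) auto
  finally have "?Q \<in> sets (borel \<Otimes>\<^sub>M ?D)" .
  then have "(\<lambda>x. emeasure ?D (Pair x -` ?Q)) \<in> borel_measurable borel"
    by (rule D.measurable_emeasure_Pair)
  also have "(\<lambda>x. emeasure ?D (Pair x -` ?Q)) = (\<lambda>x. emeasure \<mu> (X_ball x \<epsilon>))"
  proof
    fix x
    have "Pair x -` ?Q = ball x \<epsilon>" by auto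
    then show "emeasure ?D (Pair x -` ?Q) = emeasure \<mu> (X_ball x \<epsilon>)"
      by (simp add: emeasure_distr borel_measurable_mu space_mu X_ball_def phase_space_def)
  qed
  finally show ?thesis unfolding measure_def by measurable
qed

text \<open>With J the mean of the logarithm, Jensen bounds \<open>exp (s * J \<epsilon>)\<close> by
  the partition function at 1 + s; the estimate m >= \<open>ball_lo * \<epsilon>\<close> bounds it
  from below. Both bounds are of order \<open>\<epsilon> powr s\<close> up to a logarithm.\<close>

lemma mu_quotient_limit_1: "(mu_quotient \<mu> 1 \<longlongrightarrow> 1) (at_right 0)"
proof -
  \<comment> \<open>Then 1 + s = - p, still in the range where the exponent is q - 1, so the upper
    bound has exponent exactly s.\<close>
  define s where "s = - p - 1"
  have s: "s > 0" using p_less by (simp add: s_def)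
  have exponent: "mu_exponent (1 + s) = s"
    using p_less by (simp add: mu_exponent_def s_def beta_def field_simps)
  define m where "m \<epsilon> x = measure \<mu> (X_ball x \<epsilon>)" for \<epsilon> x
  define J where "J \<epsilon> = (\<integral>x. ln (m \<epsilon> x) \<partial>\<mu>)" for \<epsilon>
  let ?B = "const_hi (1 + s) * dens_hi" and ?D = "1 / (1 - beta)"
  have main: "integrable \<mu> (\<lambda>x. ln (m \<epsilon> x)) \<and>
      ball_lo powr s * \<epsilon> powr s \<le> exp (s * J \<epsilon>) \<and> exp (s * J \<epsilon>) \<le> ?B * (?D - ln \<epsilon>) * \<epsilon> powr s"
    if \<epsilon>: "0 < \<epsilon>" "\<epsilon> \<le> 1/3" for \<epsilon>
  proof -
    have [measurable]: "m \<epsilon> \<in> borel_measurable \<mu>"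
      unfolding m_def by (intro borel_measurable_mu measure_ball_measurable)
    have AE_m: "AE x in \<mu>. ball_lo * \<epsilon> \<le> m \<epsilon> x \<and> m \<epsilon> x \<le> 1"
      using AE_mu_pos
    proof eventually_elim
      case (elim x)
      \<comment> \<open>As max x \<epsilon> <= 1, the model \<open>ball_scale\<close> is at least
        \<epsilon>, uniformly in x; this also makes the logarithm bounded.\<close>
      have "1 powr - beta \<le> max x \<epsilon> powr - beta"
        using elim \<epsilon> beta_bounds by (intro powr_mono2') auto
      then have "ball_lo * (\<epsilon> * 1) \<le> ball_lo * ball_scale \<epsilon> x"
        unfolding ball_scale_def using \<epsilon> ball_lo_pos by (intro mult_left_mono) auto
      also have "\<dots> \<le> m \<epsilon> x"
        unfolding m_def using \<epsilon> elim by (intro measure_ball_ge) auto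
      finally show ?case by (simp add: m_def)
    qed
    have pos: "0 < ball_lo * \<epsilon>" using ball_lo_pos \<epsilon> by simp
    have AE_ln: "AE x in \<mu>. ln (ball_lo * \<epsilon>) \<le> ln (m \<epsilon> x) \<and> ln (m \<epsilon> x) \<le> 0"
      using AE_m by eventually_elim (use pos in auto)
    have int: "integrable \<mu> (\<lambda>x. ln (m \<epsilon> x))"
    proof (rule integrable_const_bound[where B = "\<bar>ln (ball_lo * \<epsilon>)\<bar>"])
      show "AE x in \<mu>. norm (ln (m \<epsilon> x)) \<le> \<bar>ln (ball_lo * \<epsilon>)\<bar>"
        using AE_ln by eventually_elim auto
    qed measurable
    have AE_exp: "AE x in \<mu>. exp (s * ln (m \<epsilon> x)) = m \<epsilon> x powr s"
      using AE_m by eventually_elim (use pos in \<open>auto simp: powr_def\<close>)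
    have int_exp: "integrable \<mu> (\<lambda>x. exp (s * ln (m \<epsilon> x)))"
    proof (rule integrable_const_bound[where B = 1])
      show "AE x in \<mu>. norm (exp (s * ln (m \<epsilon> x))) \<le> 1"
        using AE_ln by eventually_elim (use s in \<open>auto simp: mult_nonneg_nonpos\<close>)
    qed measurable
    have "ln (ball_lo * \<epsilon>) = (\<integral>x. ln (ball_lo * \<epsilon>) \<partial>\<mu>)" by (simp add: prob_space)
    also have "\<dots> \<le> J \<epsilon>"
      unfolding J_def using AE_ln by (intro integral_mono_AE int) auto
    finally have "exp (s * ln (ball_lo * \<epsilon>)) \<le> exp (s * J \<epsilon>)" using s by simp
    then have lower: "ball_lo powr s * \<epsilon> powr s \<le> exp (s * J \<epsilon>)"
      using pos ball_lo_pos \<epsilon> by (simp add: powr_def exp_add[symmetric] ln_mult distrib_left)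
    have "exp (s * J \<epsilon>) = exp (\<integral>x. s * ln (m \<epsilon> x) \<partial>\<mu>)" by (simp add: J_def)
    also have "\<dots> \<le> (\<integral>x. exp (s * ln (m \<epsilon> x)) \<partial>\<mu>)"
      by (rule jensens_inequality[where I = UNIV])
        (use int int_exp in \<open>auto intro!: exp_convex\<close>)
    finally have "ennreal (exp (s * J \<epsilon>)) \<le> ennreal (\<integral>x. exp (s * ln (m \<epsilon> x)) \<partial>\<mu>)"
      by (rule ennreal_leI)
    also have "\<dots> = (\<integral>\<^sup>+x. ennreal (exp (s * ln (m \<epsilon> x))) \<partial>\<mu>)"
      using int_exp by (intro nn_integral_eq_integral[symmetric]) auto
    also have "\<dots> = Gamma_mu \<mu> \<epsilon> (1 + s)"
      unfolding Gamma_mu_def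
    proof (rule nn_integral_cong_AE)
      show "AE x in \<mu>. ennreal (exp (s * ln (m \<epsilon> x))) = epowr (emeasure \<mu> (X_ball x \<epsilon>)) (1 + s - 1)"
        using AE_exp AE_m
      proof eventually_elim
        case (elim x)
        then have "0 < m \<epsilon> x" using pos by linarith
        then show ?case using elim by (simp add: emeasure_eq_measure epowr_ennreal m_def)
      qed
    qed
    also have "\<dots> \<le> ennreal (?B * (?D - ln \<epsilon>) * \<epsilon> powr s)"
      using Gamma_mu_le[OF \<epsilon>, of "1 + s"] by (simp add: exponent)
    finally have "exp (s * J \<epsilon>) \<le> ?B * (?D - ln \<epsilon>) * \<epsilon> powr s"
      by (smt (verit, best) ennreal_le_iff2 exp_gt_zero)
    with int lower show ?thesis by simp
  qed
  have "((\<lambda>\<epsilon>. ln (exp (s * J \<epsilon>)) / ln \<epsilon>) \<longlongrightarrow> s) (at_right 0)"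
  proof (rule log_power_law_limit)
    show "ball_lo powr s > 0" using ball_lo_pos by simp
    show "?B > 0" using const_pos dens_hi_pos by simp
    show "?D > 0" using beta_bounds by simp
    show "\<forall>\<^sub>F \<epsilon> in at_right 0. ball_lo powr s * \<epsilon> powr s \<le> exp (s * J \<epsilon>) \<and>
        exp (s * J \<epsilon>) \<le> ?B * (?D - ln \<epsilon>) * \<epsilon> powr s"
      using eventually_small by eventually_elim (use main in blast)
  qed
  then have "((\<lambda>\<epsilon>. 1 / s * (ln (exp (s * J \<epsilon>)) / ln \<epsilon>)) \<longlongrightarrow> 1 / s * s) (at_right 0)"
    by (intro tendsto_intros)
  then have "((\<lambda>\<epsilon>. ereal (1 / ln \<epsilon> * J \<epsilon>)) \<longlongrightarrow> ereal 1) (at_right 0)"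
    using s by simp
  moreover have "\<forall>\<^sub>F \<epsilon> in at_right 0. ereal (1 / ln \<epsilon> * J \<epsilon>) = mu_quotient \<mu> 1 \<epsilon>"
    using eventually_small
    by eventually_elim (use main in \<open>simp add: mu_quotient_def J_def m_def\<close>)
  ultimately show ?thesis
    unfolding one_ereal_def using tendsto_cong by fastforce
qed

section \<open>Values of the measure dimensions\<close>

lemma mu_dimensions_low:
  assumes "q \<le> - p"
  shows "D_mu_plus \<mu> q = 1" "D_mu_minus \<mu> q = 1"
proof -
  have "(mu_quotient \<mu> q \<longlongrightarrow> 1) (at_right 0)"
  proof (cases "q = 1")
    case False
    have "mu_exponent q = q - 1"
      using assms p_less by (simp add: mu_exponent_def beta_def field_simps)
    then show ?thesis
      using mu_quotient_limit_neq_1[OF False] False by (simp add: one_ereal_def)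
  qed (use mu_quotient_limit_1 in simp)
  from Limsup_Liminf_at_right[OF this] show "D_mu_plus \<mu> q = 1" "D_mu_minus \<mu> q = 1"
    by (simp_all add: D_mu_plus_def D_mu_minus_def)
qed

lemma mu_dimensions_high:
  assumes "- p \<le> q"
  shows "D_mu_plus \<mu> q = ereal ((1 + 1 / p) * (q / (q - 1)))"
    "D_mu_minus \<mu> q = ereal ((1 + 1 / p) * (q / (q - 1)))"
proof -
  have "mu_exponent q = (1 + 1 / p) * q"
    using assms p_less by (simp add: mu_exponent_def beta_def field_simps)
  then have "(mu_quotient \<mu> q \<longlongrightarrow> ereal ((1 + 1 / p) * (q / (q - 1)))) (at_right 0)"
    using mu_quotient_limit_neq_1[of q] assms p_less by simp
  from Limsup_Liminf_at_right[OF this] show "D_mu_plus \<mu> q = ereal ((1 + 1 / p) * (q / (q - 1)))"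
    "D_mu_minus \<mu> q = ereal ((1 + 1 / p) * (q / (q - 1)))"
    by (simp_all add: D_mu_plus_def D_mu_minus_def)
qed

end

theorem theorem5:
  fixes p :: real and T :: "real \<Rightarrow> real" and \<mu> :: "real measure"
  assumes "p < -1"
    and "gaspard_wang_map p T"
    and "acip T \<mu>"
  shows "(\<forall>q < p + 1.
            D_tau_plus T \<mu> q = \<infinity> \<and> D_tau_minus T \<mu> q = \<infinity> \<and>
            (\<forall>a. \<forall>s \<in> {-1, 1}. Delta_tau_plus T \<mu> a s q = \<infinity> \<and> Delta_tau_minus T \<mu> a s q = \<infinity>)) \<and>
         (\<forall>q \<le> -p. D_mu_plus \<mu> q = 1 \<and> D_mu_minus \<mu> q = 1) \<and>
         (\<forall>q \<ge> -p. D_mu_plus \<mu> q = ereal ((1 + 1 / p) * (q / (q - 1))) \<and>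
                    D_mu_minus \<mu> q = ereal ((1 + 1 / p) * (q / (q - 1))))"
proof -
  interpret gaspard_wang p T \<mu> by unfold_locales (use assms in auto)
  show ?thesis
    using tau_dimensions mu_dimensions_low mu_dimensions_high by blast
qed

end
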